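(* There are absolute constants $c_1,c_2>0$ such that for every integer $n'$ there exist an integer $n\ge n'$ and a set $X$ of $n$ points that is a permutation, such that $\mathrm{WB}^{(2)}(X)\ge c_1\, n\log\log n$ but $\mathrm{WB}(X)\le c_2\, n\log\log\log n$.
   Context: Points have integer coordinates. $X$ is a permutation if every horizontal and every vertical line contains at most one point of $X$. For non-collinear points $p,q$ (differing in both coordinates), $\square_{p,q}$ is the smallest closed axis-parallel rectangle containing both. Strong (first) Wilber bound: let $B$ be the bounding box of $X$ and $\mathcal L(X)$ the vertical lines with half-integral $x$-coordinate strictly between the minimum and maximum $x$-coordinates of $X$. For an ordering $\sigma$ of $\mathcal L(X)$, process lines in order starting from $\{B\}$; each line $L$ splits the current vertical strip $S$ containing it and is charged the number of indices $j$ with $q_j,q_{j+1}$ on opposite sides of $L$, where $q_1,\dots,q_z$ are the points of $X\cap S$ in increasing $y$-order. $\mathrm{WB}_\sigma(X)$ is the total charge and $\mathrm{WB}(X)=\max_\sigma\mathrm{WB}_\sigma(X)$. Second Wilber (funnel) bound: for $p\in X$, the funnel $\mathrm{funnel}(X,p)$ is the set of points $q\in X$ with $q.y<p.y$ such that $\square_{p,q}$ contains no point of $X\setminus\{p,q\}$. Writing $\mathrm{funnel}(X,p)=\{a_1,\dots,a_r\}$ in increasing $y$-order, $\mathrm{alt}(X,p)$ is the number of indices $1\le i<r$ such that one of $a_i,a_{i+1}$ lies strictly left of $p$ and the other strictly right of $p$. Then $\mathrm{WB}^{(2)}(X)=|X|+\sum_{p\in X}\mathrm{alt}(X,p)$.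 *)

theory Defs
  imports Complex_Main
begin

type_synonym point = "int \<times> int"

definition is_permutation :: "point set \<Rightarrow> bool" where
  "is_permutation X \<longleftrightarrow>
     (\<forall>p\<in>X. \<forall>q\<in>X. (fst p = fst q \<or> snd p = snd q) \<longrightarrow> p = q)"

definition y_consecutive :: "point set \<Rightarrow> point \<Rightarrow> point \<Rightarrow> bool" where
  "y_consecutive S q q' \<longleftrightarrow> q \<in> S \<and> q' \<in> S \<and> snd q < snd q' \<and>
     \<not> (\<exists>r\<in>S. snd q < snd r \<and> snd r < snd q')"

text \<open>A vertical line with half-integral x-coordinate k + 1/2 is encoded by the integer k.
  A point p lies left of line k iff fst p \<le> k.\<close>
definition wilber_lines :: "point set \<Rightarrow> int set" where
  "wilber_lines X = {k. Min (fst ` X) \<le> k \<and> k < Max (fst ` X)}"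

definition strip_points :: "point set \<Rightarrow> int set \<Rightarrow> int \<Rightarrow> point set" where
  "strip_points X P k = {p \<in> X. \<forall>l\<in>P. (l < k \<longrightarrow> l < fst p) \<and> (k < l \<longrightarrow> fst p \<le> l)}"

definition line_charge :: "point set \<Rightarrow> int set \<Rightarrow> int \<Rightarrow> nat" where
  "line_charge X P k = card {(q, q'). y_consecutive (strip_points X P k) q q' \<and>
       ((fst q \<le> k) \<noteq> (fst q' \<le> k))}"

definition WB_sigma :: "point set \<Rightarrow> int list \<Rightarrow> nat" where
  "WB_sigma X \<sigma> = (\<Sum>i<length \<sigma>. line_charge X (set (take i \<sigma>)) (\<sigma> ! i))"

definition WB :: "point set \<Rightarrow> nat" where
  "WB X = Max (WB_sigma X ` {\<sigma>. distinct \<sigma> \<and> set \<sigma> = wilber_lines X})"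

definition in_box :: "point \<Rightarrow> point \<Rightarrow> point \<Rightarrow> bool" where
  "in_box p q r \<longleftrightarrow> min (fst p) (fst q) \<le> fst r \<and> fst r \<le> max (fst p) (fst q) \<and>
                     min (snd p) (snd q) \<le> snd r \<and> snd r \<le> max (snd p) (snd q)"

definition funnel :: "point set \<Rightarrow> point \<Rightarrow> point set" where
  "funnel X p = {q \<in> X. snd q < snd p \<and> (\<forall>r \<in> X - {p, q}. \<not> in_box p q r)}"

definition alt :: "point set \<Rightarrow> point \<Rightarrow> nat" where
  "alt X p = card {(a, a'). y_consecutive (funnel X p) a a' \<and>
       ((fst a < fst p \<and> fst p < fst a') \<or> (fst a' < fst p \<and> fst p < fst a))}"

definition WB2 :: "point set \<Rightarrow> nat" where
  "WB2 X = card X + (\<Sum>p\<in>X. alt X p)"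

end

(* Let m = 2^l. The set consists of 2^m blocks of m points; in block s the t-th point from below has
   x-coordinate m (s + 2^(i+3)) + i, where i is the bit reversal of t. The exponential spacing is
   invisible to the funnel bound, which only sees the relative order, and bit reversal gives each block
   funnel bound of order m l: if bit b of t is set, then the indices i - 2^(l-1-b) and i + 2^(l-1-b) lie
   in the funnel, at times in the dyadic interval of length 2^b just before that of t.

   For the strong bound, fix a strip (a, b] and a line k in it. Two points of classes j < i in the same
   block are at distance at least 4 m 2^i, so class i only matters in strips of that width; the pairs
   within blocks then cost at most a constant times min (2^i) (points left) (points right) for each
   relevant class i. A superadditive potential shows that such terms sum, over all lines, to a constant
   times the number of points of class i. Pairs from different blocks are few because for every fixed
   class the points move monotonically to the right with s. Altogether the strong bound is even linear in
   the number of points. *)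
theory Submission
  imports Defs
begin

subsection \<open>Alternations in a funnel\<close>

lemma permutation_snd_eq: "is_permutation X \<Longrightarrow> p \<in> X \<Longrightarrow> q \<in> X \<Longrightarrow> snd p = snd q \<Longrightarrow> p = q"
  by (auto simp: is_permutation_def)

lemma permutation_fst_eq: "is_permutation X \<Longrightarrow> p \<in> X \<Longrightarrow> q \<in> X \<Longrightarrow> fst p = fst q \<Longrightarrow> p = q"
  by (auto simp: is_permutation_def)

text \<open>Take the highest point \<open>a\<close> with \<open>Q\<close> below \<open>r\<close> and
  its successor \<open>a'\<close>. If \<open>a'\<close> satisfied \<open>Q\<close>, it would differ
  from \<open>r\<close>, hence lie below \<open>r\<close> and contradict the maximality of
  \<open>a\<close>.\<close>

lemma y_consecutive_change:
  assumes fin: "finite F" and inj: "inj_on snd F"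
    and l: "l \<in> F" "Q l" and r: "r \<in> F" "\<not> Q r" and lr: "snd l < snd r"
  shows "\<exists>a a'. y_consecutive F a a' \<and> Q a \<and> \<not> Q a' \<and> snd l \<le> snd a \<and> snd a' \<le> snd r"
proof -
  define A where "A = {q \<in> F. Q q \<and> snd q < snd r}"
  have "l \<in> A" using l lr by (simp add: A_def)
  then have A: "finite A" "A \<noteq> {}" using fin by (simp add: A_def, blast)
  have "Max (snd ` A) \<in> snd ` A" using A by (intro Max_in) auto
  then obtain a where a0: "a \<in> A" "snd a = Max (snd ` A)" by force
  have a: "a \<in> A" "\<And>q. q \<in> A \<Longrightarrow> snd q \<le> snd a"
    unfolding a0(2) using a0(1) A(1) by auto
  define B where "B = {q \<in> F. snd a < snd q}"
  have "r \<in> B" using r a(1) by (simp add: A_def B_def)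
  then have B: "finite B" "B \<noteq> {}" using fin by (simp add: B_def, blast)
  have "Min (snd ` B) \<in> snd ` B" using B by (intro Min_in) auto
  then obtain a' where a0': "a' \<in> B" "snd a' = Min (snd ` B)" by force
  have a': "a' \<in> B" "\<And>q. q \<in> B \<Longrightarrow> snd a' \<le> snd q"
    unfolding a0'(2) using a0'(1) B(1) by auto
  have 1: "y_consecutive F a a'"
    using a a' unfolding y_consecutive_def A_def B_def by fastforce
  have 2: "snd a' \<le> snd r" using a'(2)[of r] a(1) r by (auto simp: A_def B_def)
  have "\<not> Q a'"
  proof
    assume "Q a'"
    moreover have "a' \<noteq> r" using \<open>Q a'\<close> r by auto
    then have "snd a' \<noteq> snd r" using inj a'(1) r by (auto simp: B_def inj_on_def)
    ultimately have "a' \<in> A" using 2 a' by (auto simp: A_def B_def)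
    then have "snd a' \<le> snd a" by (rule a(2))
    then show False using a'(1) by (simp add: B_def)
  qed
  moreover have "snd l \<le> snd a" using a(2) \<open>l \<in> A\<close> .
  moreover have "Q a" using a(1) by (simp add: A_def)
  ultimately show ?thesis using 1 2 by blast
qed

text \<open>Each window \<open>J b\<close> of heights contains funnel points on both sides of
  \<open>p\<close>, so walking upwards from one to the other meets an alternation. By convexity its
  lower point stays in \<open>J b\<close>; disjoint windows therefore give distinct
  alternations.\<close>

lemma alt_ge_card:
  assumes fin: "finite X" and perm: "is_permutation X" and pX: "p \<in> X"
    and B: "finite B"
    and wit: "\<And>b. b \<in> B \<Longrightarrow> \<exists>l r. l \<in> funnel X p \<and> r \<in> funnel X p \<and> fst l < fst p \<and> fst p < fst r
                \<and> snd l \<in> J b \<and> snd r \<in> J b"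
    and conv: "\<And>b x y z. b \<in> B \<Longrightarrow> x \<in> J b \<Longrightarrow> z \<in> J b \<Longrightarrow> x \<le> y \<Longrightarrow> y \<le> z \<Longrightarrow> y \<in> J b"
    and disj: "\<And>b b'. b \<in> B \<Longrightarrow> b' \<in> B \<Longrightarrow> b \<noteq> b' \<Longrightarrow> J b \<inter> J b' = {}"
  shows "card B \<le> alt X p"
proof -
  let ?F = "funnel X p"
  let ?P = "{(a, a'). y_consecutive ?F a a' \<and>
       ((fst a < fst p \<and> fst p < fst a') \<or> (fst a' < fst p \<and> fst p < fst a))}"
  have FX: "?F \<subseteq> X" by (auto simp: funnel_def)
  then have finF: "finite ?F" using fin finite_subset by blast
  have inj: "inj_on snd ?F" by (rule inj_onI) (use FX permutation_snd_eq[OF perm] in blast)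
  have ne: "fst q \<noteq> fst p" if "q \<in> ?F" for q
    using permutation_fst_eq[OF perm _ pX, of q] that by (auto simp: funnel_def)
  have "\<exists>a a'. (a, a') \<in> ?P \<and> snd a \<in> J b" if b: "b \<in> B" for b
  proof -
    obtain l r where lr: "l \<in> ?F" "r \<in> ?F" "fst l < fst p" "fst p < fst r" "snd l \<in> J b" "snd r \<in> J b"
      using wit[OF b] by blast
    have "snd l \<noteq> snd r" using lr inj by (auto simp: inj_on_def)
    then consider "snd l < snd r" | "snd r < snd l" by linarith
    then show ?thesis
    proof cases
      case 1
      note y_consecutive_change[OF finF inj, of _ "\<lambda>q. fst q < fst p"]
      from this[OF lr(1) _ lr(2) _ 1] lr(3,4)
      obtain a a' where a: "y_consecutive ?F a a'" "fst a < fst p" "\<not> fst a' < fst p" "snd l \<le> snd a" "snd a' \<le> snd r"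
        by force
      have "snd a \<in> J b" using a by (intro conv[OF b lr(5,6)]) (auto simp: y_consecutive_def)
      moreover have "fst p < fst a'" using ne[of a'] a by (auto simp: y_consecutive_def)
      ultimately show ?thesis using a by blast
    next
      case 2
      note y_consecutive_change[OF finF inj, of _ "\<lambda>q. fst p < fst q"]
      from this[OF lr(2) _ lr(1) _ 2] lr(3,4)
      obtain a a' where a: "y_consecutive ?F a a'" "fst p < fst a" "\<not> fst p < fst a'" "snd r \<le> snd a" "snd a' \<le> snd l"
        by force
      have "snd a \<in> J b" using a by (intro conv[OF b lr(6,5)]) (auto simp: y_consecutive_def)
      moreover have "fst a' < fst p" using ne[of a'] a by (auto simp: y_consecutive_def)
      ultimately show ?thesis using a by blast
    qed
  qed
  then have "\<forall>b\<in>B. \<exists>u. u \<in> ?P \<and> snd (fst u) \<in> J b" by fastforce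
  then have "\<exists>f. \<forall>b\<in>B. f b \<in> ?P \<and> snd (fst (f b)) \<in> J b" by (rule bchoice)
  then obtain f where f': "\<forall>b\<in>B. f b \<in> ?P \<and> snd (fst (f b)) \<in> J b" ..
  have f: "f b \<in> ?P \<and> snd (fst (f b)) \<in> J b" if "b \<in> B" for b
    using f' that by (rule bspec)
  have "inj_on f B"
  proof (rule inj_onI, rule ccontr)
    fix b b' assume b: "b \<in> B" "b' \<in> B" "f b = f b'" "b \<noteq> b'"
    then have "snd (fst (f b)) \<in> J b \<inter> J b'" using f[OF b(1)] f[OF b(2)] by simp
    then show False using disj[OF b(1,2,4)] by simp
  qed
  moreover have "f ` B \<subseteq> ?P" by (rule image_subsetI) (rule conjunct1[OF f])
  moreover have "finite ?P"
    by (rule finite_subset[of _ "?F \<times> ?F"]) (auto simp: y_consecutive_def finF)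
  ultimately show ?thesis unfolding alt_def by (rule card_inj_on_le)
qed

subsection \<open>Bit reversal\<close>

fun bit_rev :: "nat \<Rightarrow> nat \<Rightarrow> nat" where
  "bit_rev 0 t = 0"
| "bit_rev (Suc l) t = 2 * bit_rev l (t mod 2 ^ l) + t div 2 ^ l"

lemma bit_rev_less: "t < 2 ^ l \<Longrightarrow> bit_rev l t < 2 ^ l"
proof (induction l arbitrary: t)
  case (Suc l)
  have "bit_rev l (t mod 2 ^ l) < 2 ^ l" using Suc.IH by simp
  moreover have "t div 2 ^ l < 2" using Suc.prems by (simp add: less_mult_imp_div_less)
  ultimately show ?case by simp
qed simp

text \<open>The last \<open>k\<close> bits of the reversal are the first \<open>k\<close> bits of
  \<open>t\<close>. The induction peels off the leading bit of \<open>t\<close>, which is the last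
  bit of the reversal.\<close>

lemma bit_rev_cong_iff:
  assumes "t < 2 ^ l" "t' < 2 ^ l" "k \<le> l"
  shows "bit_rev l t mod 2 ^ k = bit_rev l t' mod 2 ^ k \<longleftrightarrow> t div 2 ^ (l - k) = t' div 2 ^ (l - k)"
  using assms
proof (induction l arbitrary: t t' k)
  case (Suc l)
  show ?case
  proof (cases k)
    case 0
    then show ?thesis using Suc.prems by simp
  next
    case (Suc j)
    have j: "j \<le> l" using Suc Suc.prems by simp
    \<comment> \<open>Both sides of the equivalence are separated at the leading bit: here for the
      quotients, in \<open>eql\<close> for the residues of the reversals.\<close>
    have split: "u div 2 ^ (l - j) = (u div 2 ^ l) * 2 ^ j + (u mod 2 ^ l) div 2 ^ (l - j)" for u :: nat
    proof -
      have e: "(2::nat) ^ l = 2 ^ (l - j) * 2 ^ j" using j by (simp flip: power_add)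
      have "u = 2 ^ (l - j) * ((u div 2 ^ l) * 2 ^ j) + u mod 2 ^ l"
        using e by (metis div_mult_mod_eq mult.commute mult.assoc)
      then show ?thesis
        by (metis div_mult_self2 add.commute power_eq_0_iff zero_neq_numeral)
    qed
    have small: "(u mod 2 ^ l) div 2 ^ (l - j) < 2 ^ j" for u :: nat
    proof -
      have e: "(2::nat) ^ l = 2 ^ j * 2 ^ (l - j)" using j by (simp flip: power_add)
      show ?thesis by (rule less_mult_imp_div_less) (simp flip: e)
    qed
    have eqr: "t div 2 ^ (l - j) = t' div 2 ^ (l - j) \<longleftrightarrow>
        t div 2 ^ l = t' div 2 ^ l \<and> (t mod 2 ^ l) div 2 ^ (l - j) = (t' mod 2 ^ l) div 2 ^ (l - j)"
      (is "_ \<longleftrightarrow> ?R")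
    proof
      assume h: "t div 2 ^ (l - j) = t' div 2 ^ (l - j)"
      have "u div 2 ^ (l - j) div 2 ^ j = u div 2 ^ l" for u :: nat
        using j by (simp flip: div_mult2_eq power_add)
      then have "t div 2 ^ l = t' div 2 ^ l" using h by metis
      then show ?R using h split[of t] split[of t'] by simp
    next
      assume ?R then show "t div 2 ^ (l - j) = t' div 2 ^ (l - j)" using split[of t] split[of t'] by simp
    qed
    have eql: "(2 * x + d) mod 2 ^ Suc j = (2 * x' + d') mod 2 ^ Suc j \<longleftrightarrow> d = d' \<and> x mod 2 ^ j = x' mod 2 ^ j"
      if "d < 2" "d' < 2" for x x' d d' :: nat
    proof -
      have e: "(2 * u + c) mod 2 ^ Suc j = 2 * (u mod 2 ^ j) + c" if "c < 2" for u c :: nat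
      proof -
        have "(2 * u + c) mod (2 * 2 ^ j) = 2 * ((2 * u + c) div 2 mod 2 ^ j) + (2 * u + c) mod 2"
          by (rule mod_mult2_eq)
        then show ?thesis using that by simp
      qed
      have "2 * a + d = 2 * b + d' \<longleftrightarrow> d = d' \<and> a = b" for a b :: nat
        using that by presburger
      then show ?thesis unfolding e[OF that(1)] e[OF that(2)] .
    qed
    have d: "u div 2 ^ l < 2" if "u < 2 ^ Suc l" for u :: nat
      using that by (simp add: less_mult_imp_div_less)
    have IH: "bit_rev l (t mod 2 ^ l) mod 2 ^ j = bit_rev l (t' mod 2 ^ l) mod 2 ^ j \<longleftrightarrow>
       (t mod 2 ^ l) div 2 ^ (l - j) = (t' mod 2 ^ l) div 2 ^ (l - j)"
      by (rule Suc.IH) (use j in auto)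
    show ?thesis
      using eql[OF d[OF Suc.prems(1)] d[OF Suc.prems(2)]] IH eqr Suc by simp
  qed
qed simp

lemma bit_rev_inj: "inj_on (bit_rev l) {..<2 ^ l}"
  by (rule inj_onI) (metis bit_rev_cong_iff diff_self_eq_0 div_by_1 le_refl lessThan_iff power_0)

lemma bit_rev_surj: "i < 2 ^ l \<Longrightarrow> \<exists>t<2 ^ l. bit_rev l t = i"
proof -
  assume i: "i < 2 ^ l"
  have "bit_rev l ` {..<2 ^ l} = {..<2 ^ l}"
    by (rule card_subset_eq) (auto simp: bit_rev_less card_image[OF bit_rev_inj])
  then show ?thesis using i by (metis imageE lessThan_iff)
qed

text \<open>Adding \<open>2 ^ b\<close> injects the numbers with even quotient into those with odd
  quotient. It does not leave the range, because \<open>2 ^ (l - b)\<close> is even and so the last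
  quotient is odd.\<close>

lemma card_odd_div:
  assumes "b < l"
  shows "2 ^ (l - 1) \<le> card {t::nat. t < 2 ^ l \<and> odd (t div 2 ^ b)}"
proof -
  let ?E = "{t::nat. t < 2 ^ l \<and> even (t div 2 ^ b)}"
  let ?O = "{t::nat. t < 2 ^ l \<and> odd (t div 2 ^ b)}"
  have "(\<lambda>t. t + 2 ^ b) ` ?E \<subseteq> ?O"
  proof clarify
    fix t :: nat assume t: "t < 2 ^ l" "even (t div 2 ^ b)"
    have e: "(2::nat) ^ l = 2 ^ (l - b) * 2 ^ b" "even ((2::nat) ^ (l - b))"
      using assms by (auto simp flip: power_add)
    have "t div 2 ^ b < 2 ^ (l - b)" using t e by (simp add: less_mult_imp_div_less)
    then have "t div 2 ^ b + 1 < 2 ^ (l - b)" using t e(2) by (metis Suc_eq_plus1 Suc_lessI even_Suc)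
    moreover have q: "(t + 2 ^ b) div 2 ^ b = t div 2 ^ b + 1" by simp
    ultimately have "(t + 2 ^ b) div 2 ^ b < 2 ^ (l - b)" by simp
    then have "t + 2 ^ b < 2 ^ l" unfolding e(1) by (subst (asm) div_less_iff_less_mult) auto
    then show "t + 2 ^ b < 2 ^ l \<and> odd ((t + 2 ^ b) div 2 ^ b)" using t q by simp
  qed
  then have "card ?E \<le> card ?O" by (intro card_inj_on_le[of "\<lambda>t. t + 2 ^ b"]) auto
  moreover have "card ?E + card ?O = 2 ^ l"
  proof -
    have "card (?E \<union> ?O) = card ?E + card ?O" by (rule card_Un_disjoint) auto
    moreover have "?E \<union> ?O = {..<2 ^ l}" by auto
    ultimately show ?thesis by simp
  qed
  moreover have "(2::nat) ^ l = 2 * 2 ^ (l - 1)" using assms by (simp flip: power_Suc)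
  ultimately show ?thesis by linarith
qed

subsection \<open>Potentials and residue classes\<close>

text \<open>Cutting a mass \<open>r1 + r2 >= K\<close> at cost \<open>min K (min r1 r2)\<close> is
  paid by the drop of this potential. As it is at most \<open>2 * r\<close>, a whole recursive
  splitting costs an amount linear in the mass, without a logarithm.\<close>

definition pot :: "int \<Rightarrow> int \<Rightarrow> int" where
  "pot K r = (if r < K then 0 else 2 * r - K)"

lemma pot_nonneg: "0 \<le> K \<Longrightarrow> 0 \<le> pot K r"
  by (simp add: pot_def)

lemma pot_le: "0 \<le> K \<Longrightarrow> 0 \<le> r \<Longrightarrow> pot K r \<le> 2 * r"
  by (simp add: pot_def)

lemma pot_mono_split:
  assumes "0 \<le> r1" "0 \<le> r2" "0 \<le> K"
  shows "pot K r1 + pot K r2 \<le> pot K (r1 + r2)"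
  using assms by (auto simp: pot_def)

text \<open>The drop is \<open>K\<close> if both parts reach \<open>K\<close>, twice the smaller
  part if only one does, and \<open>2 * (r1 + r2) - K >= r1 + r2\<close> if none does.\<close>

lemma pot_split:
  assumes "0 \<le> r1" "0 \<le> r2" "0 \<le> K" "K \<le> r1 + r2"
  shows "min K (min r1 r2) + pot K r1 + pot K r2 \<le> pot K (r1 + r2)"
  using assms by (auto simp: pot_def)

text \<open>For \<open>a <= b\<close> and \<open>m > 0\<close> this counts the integers in (a, b]
  congruent to \<open>j\<close> modulo \<open>m\<close>. The form with floors is exactly additive
  when the interval is cut.\<close>

definition res_count :: "nat \<Rightarrow> nat \<Rightarrow> int \<Rightarrow> int \<Rightarrow> int" where
  "res_count m j a b = (b - int j) div int m - (a - int j) div int m"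

lemma res_count_add: "res_count m j a k + res_count m j k b = res_count m j a b"
  by (simp add: res_count_def)

lemma res_count_bounds:
  assumes "0 < m"
  shows "b - a - int m < int m * res_count m j a b" "int m * res_count m j a b < b - a + int m"
proof -
  let ?x = "a - int j" and ?y = "b - int j"
  have "?x = int m * (?x div int m) + ?x mod int m" "?y = int m * (?y div int m) + ?y mod int m" by simp_all
  moreover have "0 \<le> ?x mod int m" "?x mod int m < int m" "0 \<le> ?y mod int m" "?y mod int m < int m"
    using assms by simp_all
  ultimately show "b - a - int m < int m * res_count m j a b" "int m * res_count m j a b < b - a + int m"
    unfolding res_count_def right_diff_distrib by linarith+
qed

lemma res_count_nonneg: "0 < m \<Longrightarrow> a \<le> b \<Longrightarrow> 0 \<le> res_count m j a b"
  by (simp add: res_count_def zdiv_mono1)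

lemma res_count_ge:
  assumes "0 < m" "int m * q \<le> b - a" shows "q \<le> res_count m j a b"
proof -
  have "int m * (q - 1) < int m * res_count m j a b"
    using res_count_bounds(1)[OF assms(1), of b a j] assms(2) by (simp add: right_diff_distrib)
  then show ?thesis using assms(1) by simp
qed

text \<open>Each count differs from its width divided by \<open>m\<close> by less than 1.\<close>

lemma res_count_le_Suc:
  assumes "0 < m" "b - a \<le> b' - a'" shows "res_count m j a b \<le> res_count m j a' b' + 1"
proof -
  have "int m * res_count m j a b < int m * (res_count m j a' b' + 2)"
    using res_count_bounds(2)[OF assms(1), of j a b] res_count_bounds(1)[OF assms(1), of b' a' j] assms(2)
    by (simp add: distrib_left)
  then show ?thesis using assms(1) by simp
qed

lemma card_res_class:
  assumes m: "0 < m" and inj: "inj_on fst Y"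
    and Y: "\<And>p. p \<in> Y \<Longrightarrow> fst p mod int m = int j \<and> a < fst p \<and> fst p \<le> b" and ab: "a \<le> b"
  shows "int (card Y) \<le> res_count m j a b"
proof -
  have eq: "fst p = int m * (fst p div int m) + int j" if "p \<in> Y" for p
    using Y[OF that] by (metis mult_div_mod_eq)
  have "inj_on (\<lambda>p. fst p div int m) Y"
    using inj eq unfolding inj_on_def by metis
  moreover have "(\<lambda>p. fst p div int m) ` Y \<subseteq> {(a - int j) div int m <.. (b - int j) div int m}"
  proof clarify
    fix x y assume p: "(x, y) \<in> Y"
    let ?c = "x div int m"
    have "x = int m * ?c + int j" "a < x" "x \<le> b" using eq[OF p] Y[OF p] by auto
    then have 1: "a - int j < ?c * int m" and 2: "?c * int m \<le> b - int j" by (auto simp: mult.commute)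
    have "(a - int j) div int m * int m \<le> a - int j"
      using m pos_mod_sign[of "int m" "a - int j"] div_mult_mod_eq[of "a - int j" "int m"] by linarith
    then have "(a - int j) div int m * int m < ?c * int m" using 1 by linarith
    then have "(a - int j) div int m < ?c" using m by simp
    moreover have "?c \<le> (b - int j) div int m" using zdiv_mono1[OF 2, of "int m"] m by simp
    ultimately show "fst (x, y) div int m \<in> {(a - int j) div int m <.. (b - int j) div int m}" by simp
  qed
  ultimately have "card Y \<le> card {(a - int j) div int m <.. (b - int j) div int m}"
    by (intro card_inj_on_le) auto
  moreover have "(a - int j) div int m \<le> (b - int j) div int m" using ab m by (simp add: zdiv_mono1)
  ultimately show ?thesis by (simp add: res_count_def)
qed

subsection \<open>Summing over an ordering of the lines\<close>

definition strip :: "point set \<Rightarrow> int \<Rightarrow> int \<Rightarrow> point set" where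
  "strip X a b = {p \<in> X. a < fst p \<and> fst p \<le> b}"

definition crossings :: "point set \<Rightarrow> int \<Rightarrow> int \<Rightarrow> int \<Rightarrow> (point \<times> point) set" where
  "crossings X a k b = {(q, q'). y_consecutive (strip X a b) q q' \<and> (fst q \<le> k) \<noteq> (fst q' \<le> k)}"

text \<open>The lines processed so far cut the plane into gaps; \<open>lo\<close> and
  \<open>hi\<close> serve as sentinels for the outermost ones.\<close>

definition succ_line :: "int \<Rightarrow> int set \<Rightarrow> int \<Rightarrow> int" where
  "succ_line hi P a = Min {l \<in> insert hi P. a < l}"

definition pred_line :: "int \<Rightarrow> int set \<Rightarrow> int \<Rightarrow> int" where
  "pred_line lo P b = Max {l \<in> insert lo P. l < b}"

lemma line_charge_eq:
  assumes fin: "finite P" and k: "lo < k" "k < hi" "k \<notin> P"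
    and X: "\<And>p. p \<in> X \<Longrightarrow> lo < fst p \<and> fst p \<le> hi"
  shows "line_charge X P k = card (crossings X (pred_line lo P k) k (succ_line hi P k))"
proof -
  have "strip_points X P k = strip X (pred_line lo P k) (succ_line hi P k)"
  proof -
    have 1: "pred_line lo P k < x \<longleftrightarrow> lo < x \<and> (\<forall>l\<in>P. l < k \<longrightarrow> l < x)" for x
      unfolding pred_line_def using fin k by (subst Max_less_iff) auto
    have 2: "x \<le> succ_line hi P k \<longleftrightarrow> x \<le> hi \<and> (\<forall>l\<in>P. k < l \<longrightarrow> x \<le> l)" for x
      unfolding succ_line_def using fin k by (subst Min_ge_iff) auto
    show ?thesis using X unfolding strip_points_def strip_def 1 2 by auto
  qed
  then show ?thesis by (simp add: line_charge_def crossings_def)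
qed

text \<open>Gaps are indexed by their left ends. The new line \<open>k\<close> replaces the gap from
  \<open>a\<close> to \<open>b\<close> by two gaps and leaves all others as they were.\<close>

lemma gap_sum_insert:
  fixes w :: "int \<Rightarrow> int \<Rightarrow> int"
  assumes fin: "finite P" and P: "P \<subseteq> {lo<..<hi}" and k: "lo < k" "k < hi" "k \<notin> P"
  defines "a \<equiv> pred_line lo P k" and "b \<equiv> succ_line hi P k"
  shows "(\<Sum>c\<in>insert lo (insert k P). w c (succ_line hi (insert k P) c)) + w a b
       = (\<Sum>c\<in>insert lo P. w c (succ_line hi P c)) + w a k + w k b"
    and "a < k" "k < b"
proof -
  let ?A = "{l \<in> insert lo P. l < k}" and ?B = "{l \<in> insert hi P. k < l}"
  have finA: "finite ?A" "?A \<noteq> {}" and finB: "finite ?B" "?B \<noteq> {}" using fin k by auto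
  have aA: "a \<in> ?A" unfolding a_def pred_line_def using finA by (rule Max_in)
  have bB: "b \<in> ?B" unfolding b_def succ_line_def using finB by (rule Min_in)
  have amax: "l \<le> a" if "l \<in> ?A" for l unfolding a_def pred_line_def using finA(1) that by (rule Max_ge)
  have bmin: "b \<le> l" if "l \<in> ?B" for l unfolding b_def succ_line_def using finB(1) that by (rule Min_le)
  show "a < k" "k < b" using aA bB by auto
  have sa: "succ_line hi P a = b"
    unfolding succ_line_def
  proof (rule Min_eqI)
    fix l assume l: "l \<in> {l \<in> insert hi P. a < l}"
    then have "l \<noteq> k" "\<not> l < k" using amax[of l] k by auto
    then show "b \<le> l" using l bmin[of l] by auto
  qed (use fin aA bB in auto)
  have sa': "succ_line hi (insert k P) a = k"
    unfolding succ_line_def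
  proof (rule Min_eqI)
    fix l assume l: "l \<in> {l \<in> insert hi (insert k P). a < l}"
    then show "k \<le> l" using amax[of l] k by force
  qed (use fin aA in auto)
  have sk: "succ_line hi (insert k P) k = b"
    unfolding b_def succ_line_def by (rule arg_cong[of _ _ Min]) auto
  \<comment> \<open>A gap starting right of \<open>k\<close> does not see \<open>k\<close>, and one
    starting left of \<open>a\<close> ends at \<open>a\<close> or earlier.\<close>
  have so: "succ_line hi (insert k P) c = succ_line hi P c" if c: "c \<in> insert lo P" "c \<noteq> a" for c
  proof (cases "c < k")
    case False
    then have "{l \<in> insert hi (insert k P). c < l} = {l \<in> insert hi P. c < l}" by auto
    then show ?thesis by (simp add: succ_line_def)
  next
    case True
    then have "c < a" using amax[of c] c by auto
    then have "a \<in> P" using aA c P by auto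
    then have "Min {l \<in> insert hi P. c < l} \<le> a" using fin \<open>c < a\<close> by (intro Min_le) auto
    moreover have "{l \<in> insert hi (insert k P). c < l} = insert k {l \<in> insert hi P. c < l}" using True by auto
    moreover have "Min (insert k {l \<in> insert hi P. c < l}) = min k (Min {l \<in> insert hi P. c < l})"
      by (rule Min_insert) (use fin True k in auto)
    ultimately show ?thesis using aA by (simp add: succ_line_def)
  qed
  have kn: "k \<notin> insert lo P" using k by auto
  have fi: "finite (insert lo P)" using fin by simp
  have "(\<Sum>c\<in>insert lo (insert k P). w c (succ_line hi (insert k P) c))
      = w k b + (\<Sum>c\<in>insert lo P. w c (succ_line hi (insert k P) c))"
    using kn fi by (subst insert_commute, subst sum.insert) (auto simp: sk)
  also have "(\<Sum>c\<in>insert lo P. w c (succ_line hi (insert k P) c))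
      = w a k + (\<Sum>c\<in>insert lo P - {a}. w c (succ_line hi (insert k P) c))"
    using aA fi by (subst sum.remove[of _ a]) (auto simp: sa')
  also have "(\<Sum>c\<in>insert lo P - {a}. w c (succ_line hi (insert k P) c))
      = (\<Sum>c\<in>insert lo P - {a}. w c (succ_line hi P c))"
    by (rule sum.cong) (auto simp: so)
  finally have "(\<Sum>c\<in>insert lo (insert k P). w c (succ_line hi (insert k P) c))
      = w k b + (w a k + (\<Sum>c\<in>insert lo P - {a}. w c (succ_line hi P c)))" .
  moreover have "(\<Sum>c\<in>insert lo P. w c (succ_line hi P c))
      = w a b + (\<Sum>c\<in>insert lo P - {a}. w c (succ_line hi P c))"
    using aA fi by (subst sum.remove[of _ a]) (auto simp: sa)
  ultimately show "(\<Sum>c\<in>insert lo (insert k P). w c (succ_line hi (insert k P) c)) + w a b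
       = (\<Sum>c\<in>insert lo P. w c (succ_line hi P c)) + w a k + w k b" by simp
qed

text \<open>Amortisation: the charge so far plus the potential of all current gaps never exceeds
  \<open>w lo hi\<close>, since each line splits one gap and the drop of \<open>w\<close> pays for
  its charge. The induction appends lines at the end because a charge depends on all earlier
  lines.\<close>

lemma WB_sigma_le_potential:
  fixes w :: "int \<Rightarrow> int \<Rightarrow> int"
  assumes X: "\<And>p. p \<in> X \<Longrightarrow> lo < fst p \<and> fst p \<le> hi" and lohi: "lo < hi"
    and w: "\<And>a k b. a < k \<Longrightarrow> k < b \<Longrightarrow> int (card (crossings X a k b)) + w a k + w k b \<le> w a b"
    and nonneg: "\<And>a b. a < b \<Longrightarrow> 0 \<le> w a b"
    and \<sigma>: "distinct \<sigma>" "set \<sigma> \<subseteq> {lo<..<hi}"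
  shows "int (WB_sigma X \<sigma>) \<le> w lo hi"
proof -
  have *: "int (WB_sigma X \<sigma>) + (\<Sum>c\<in>insert lo (set \<sigma>). w c (succ_line hi (set \<sigma>) c)) \<le> w lo hi"
    using \<sigma>
  proof (induction \<sigma> rule: rev_induct)
    case Nil
    have "{l. l = hi \<and> lo < l} = {hi}" using lohi by auto
    then show ?case by (simp add: WB_sigma_def succ_line_def)
  next
    case (snoc k \<sigma>)
    have k: "lo < k" "k < hi" "k \<notin> set \<sigma>" "set \<sigma> \<subseteq> {lo<..<hi}" "distinct \<sigma>" using snoc.prems by auto
    have "WB_sigma X (\<sigma> @ [k]) = WB_sigma X \<sigma> + line_charge X (set \<sigma>) k"
      by (simp add: WB_sigma_def nth_append)
    moreover have "line_charge X (set \<sigma>) k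
        = card (crossings X (pred_line lo (set \<sigma>) k) k (succ_line hi (set \<sigma>) k))"
      by (rule line_charge_eq) (use k X in auto)
    moreover note gap_sum_insert(1)[OF _ k(4,1,2,3), of w] snoc.IH[OF k(5,4)]
    moreover note w[OF gap_sum_insert(2)[OF _ k(4,1,2,3)] gap_sum_insert(3)[OF _ k(4,1,2,3)]]
    ultimately show ?case by (simp del: insert_iff)
  qed
  moreover have "0 \<le> (\<Sum>c\<in>insert lo (set \<sigma>). w c (succ_line hi (set \<sigma>) c))"
  proof (rule sum_nonneg)
    fix c assume c: "c \<in> insert lo (set \<sigma>)"
    then have "c < hi" using \<sigma> lohi by auto
    then have "succ_line hi (set \<sigma>) c \<in> {l \<in> insert hi (set \<sigma>). c < l}"
      unfolding succ_line_def by (intro Min_in) auto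
    then show "0 \<le> w c (succ_line hi (set \<sigma>) c)" using nonneg by auto
  qed
  ultimately show ?thesis by linarith
qed

subsection \<open>The strong Wilber bound of exponentially spaced shifts\<close>

text \<open>The features of the set that enter the strong bound: the residue of x modulo
  \<open>m\<close> is the class, the column exceeds the block by a power of two given by the class,
  and by \<open>full\<close> each class occupies an interval of blocks. The vertical order inside a
  block is left open, so bit reversal does not enter here.\<close>

locale shifted_powers =
  fixes m :: nat and X :: "point set"
  assumes m_pos: "0 < m" and fin: "finite X" and perm: "is_permutation X"
    and column: "p \<in> X \<Longrightarrow> fst p div int m = snd p div int m + 2 ^ (nat (fst p mod int m) + 3)"
    and full: "p \<in> X \<Longrightarrow> q \<in> X \<Longrightarrow> fst p mod int m = fst q mod int m \<Longrightarrow>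
        snd p div int m \<le> s \<Longrightarrow> s \<le> snd q div int m \<Longrightarrow>
        \<exists>r\<in>X. snd r div int m = s \<and> fst r mod int m = fst p mod int m"
begin

section \<open>Blocks, residue classes and columns\<close>

definition block :: "point \<Rightarrow> int" where "block p = snd p div int m"
definition cls :: "point \<Rightarrow> nat" where "cls p = nat (fst p mod int m)"
definition col :: "point \<Rightarrow> int" where "col p = fst p div int m"

lemma cls_less: "cls p < m"
  using m_pos by (simp add: cls_def nat_less_iff)

lemma int_cls: "int (cls p) = fst p mod int m"
  using m_pos by (simp add: cls_def)

lemma fst_eq: "fst p = int m * col p + int (cls p)"
  by (simp add: col_def int_cls)

lemma col_eq: "p \<in> X \<Longrightarrow> col p = block p + 2 ^ (cls p + 3)"
  using column by (simp add: col_def block_def cls_def)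

lemma block_mono: "snd p \<le> snd q \<Longrightarrow> block p \<le> block q"
  using m_pos by (simp add: block_def zdiv_mono1)

lemma block_full:
  assumes "p \<in> X" "q \<in> X" "cls p = cls q" "block p \<le> s" "s \<le> block q"
  obtains r where "r \<in> X" "block r = s" "cls r = cls p"
  using full[of p q s] assms int_cls[of p] int_cls[of q] unfolding block_def cls_def by metis

lemma point_eqI: "p \<in> X \<Longrightarrow> q \<in> X \<Longrightarrow> cls p = cls q \<Longrightarrow> block p = block q \<Longrightarrow> p = q"
  using permutation_fst_eq[OF perm, of p q] by (simp add: fst_eq col_eq)

lemma fst_mono:
  assumes "p \<in> X" "q \<in> X" "cls p = cls q" "block p \<le> block q"
  shows "fst p \<le> fst q"
  using assms m_pos by (simp add: fst_eq col_eq)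

lemma col_mono: "fst p \<le> fst q \<Longrightarrow> col p \<le> col q"
  using m_pos by (simp add: col_def zdiv_mono1)

lemma stripD: "p \<in> strip X a b \<Longrightarrow> p \<in> X \<and> a < fst p \<and> fst p \<le> b"
  by (simp add: strip_def)

lemma finite_strip: "finite (strip X a b)"
  using fin by (simp add: strip_def)

lemma inj_fst_strip: "inj_on fst (strip X a b)"
  by (rule inj_onI) (use permutation_fst_eq[OF perm] stripD in blast)

lemma snd_inj: "p \<in> X \<Longrightarrow> q \<in> X \<Longrightarrow> snd p = snd q \<Longrightarrow> p = q"
  using permutation_snd_eq[OF perm] .

lemma finite_crossings: "finite (crossings X a k b)"
  by (rule finite_subset[of _ "strip X a b \<times> strip X a b"])
     (auto simp: crossings_def y_consecutive_def finite_strip)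

lemma crossingsD:
  assumes "(q, q') \<in> crossings X a k b"
  shows "q \<in> strip X a b" "q' \<in> strip X a b" "q \<in> X" "q' \<in> X" "snd q < snd q'"
    "(fst q \<le> k) \<noteq> (fst q' \<le> k)" "r \<in> strip X a b \<Longrightarrow> snd q < snd r \<Longrightarrow> snd q' \<le> snd r"
    "r \<in> strip X a b \<Longrightarrow> snd r < snd q' \<Longrightarrow> snd r \<le> snd q"
  using assms by (fastforce simp: crossings_def y_consecutive_def dest: stripD)+

text \<open>The successor in y-order inside the strip is unique, so a crossing is determined by its
  lower point, and symmetrically by its upper point.\<close>

lemma crossings_inj_fst: "inj_on fst (crossings X a k b)"
proof (rule inj_onI)
  fix u v assume uv: "u \<in> crossings X a k b" "v \<in> crossings X a k b" "fst u = fst v"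
  have A: "(fst u, snd u) \<in> crossings X a k b" "(fst v, snd v) \<in> crossings X a k b" using uv(1,2) by simp_all
  have "snd (snd u) \<le> snd (snd v)" "snd (snd v) \<le> snd (snd u)"
    using crossingsD(7)[OF A(1) crossingsD(2)[OF A(2)]] crossingsD(5)[OF A(2)]
      crossingsD(7)[OF A(2) crossingsD(2)[OF A(1)]] crossingsD(5)[OF A(1)] uv(3) by simp_all
  then have "snd u = snd v" using snd_inj[OF crossingsD(4)[OF A(1)] crossingsD(4)[OF A(2)]] by simp
  then show "u = v" using uv(3) by (rule prod_eqI[rotated])
qed

lemma crossings_inj_snd: "inj_on snd (crossings X a k b)"
proof (rule inj_onI)
  fix u v assume uv: "u \<in> crossings X a k b" "v \<in> crossings X a k b" "snd u = snd v"
  have A: "(fst u, snd u) \<in> crossings X a k b" "(fst v, snd v) \<in> crossings X a k b" using uv(1,2) by simp_all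
  have "snd (fst u) \<le> snd (fst v)" "snd (fst v) \<le> snd (fst u)"
    using crossingsD(8)[OF A(1) crossingsD(1)[OF A(2)]] crossingsD(5)[OF A(2)]
      crossingsD(8)[OF A(2) crossingsD(1)[OF A(1)]] crossingsD(5)[OF A(1)] uv(3) by simp_all
  then have "fst u = fst v" using snd_inj[OF crossingsD(3)[OF A(1)] crossingsD(3)[OF A(2)]] by simp
  then show "u = v" using uv(3) by (rule prod_eqI)
qed

section \<open>Strips of width at most \<open>m\<close>\<close>

text \<open>Inside one column a larger class means a smaller block, so points further right lie
  lower. Of two points in adjacent columns less than \<open>m\<close> apart, the right one has the
  smaller class, hence the larger block, and lies higher.\<close>

lemma narrow_step:
  assumes "b - a \<le> int m" "p \<in> strip X a b" "q \<in> strip X a b" "snd p < snd q"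
  shows "fst p < fst q \<Longrightarrow> col q = col p + 1" "fst q < fst p \<Longrightarrow> col q = col p"
proof -
  have X: "p \<in> X" "q \<in> X" and d: "\<bar>fst p - fst q\<bar> < int m" using assms by (auto dest!: stripD)
  have bl: "block p \<le> block q" using assms block_mono by simp
  have near: "col u \<le> col v + 1 \<and> (col u = col v + 1 \<longrightarrow> cls u < cls v)"
    if "fst u - fst v < int m" for u v
  proof -
    have "int m * (col u - col v) < int m + int (cls v) - int (cls u)"
      using that by (simp add: fst_eq right_diff_distrib)
    moreover from this have "int m * (col u - col v) < int m * 2" using cls_less[of v] by linarith
    then have "col u - col v < 2" using m_pos by simp
    ultimately show ?thesis by auto
  qed
  have pw: "(2::int) ^ (i + 3) < 2 ^ (j + 3)" if "i < j" for i j using that by simp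
  show "col q = col p + 1" if lt: "fst p < fst q"
  proof -
    have "col p \<le> col q" using lt col_mono by simp
    moreover have "col q \<noteq> col p"
    proof
      assume c: "col q = col p"
      then have "cls p < cls q" using lt by (simp add: fst_eq)
      then show False using c col_eq[OF X(1)] col_eq[OF X(2)] bl pw[of "cls p" "cls q"] by linarith
    qed
    moreover have "fst q - fst p < int m" using d by linarith
    ultimately show ?thesis using near[of q p] by linarith
  qed
  show "col q = col p" if lt: "fst q < fst p"
  proof -
    have "col q \<le> col p" using lt col_mono by simp
    moreover have "col p \<noteq> col q + 1"
    proof
      assume c: "col p = col q + 1"
      moreover have "fst p - fst q < int m" using d by linarith
      ultimately have "cls p < cls q" using near[of p q] by simp
      then show False using c col_eq[OF X(1)] col_eq[OF X(2)] bl pw[of "cls p" "cls q"] by linarith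
    qed
    moreover have "fst p - fst q < int m" using d by linarith
    ultimately show ?thesis using near[of p q] by linarith
  qed
qed

text \<open>A crossing is determined by the side and the column of its lower point: between two
  crossings that start on the same side the path goes over the line and back, and exactly one of
  these two moves raises the column.\<close>

lemma narrow_crossings:
  assumes w: "b - a \<le> int m"
  shows "card (crossings X a k b) \<le> 4"
proof -
  let ?f = "\<lambda>(q, q'). (fst q \<le> k, col q)"
  let ?c = "(a + 1) div int m"
  have no: False if A: "(q1, q1') \<in> crossings X a k b" "(q2, q2') \<in> crossings X a k b"
    "(fst q1 \<le> k) = (fst q2 \<le> k)" "col q1 = col q2" "snd q1 < snd q2" for q1 q1' q2 q2'
  proof -
    note D = crossingsD[OF A(1)] and E = crossingsD[OF A(2)]
    have "snd q1' \<le> snd q2" using D(7)[OF E(1)] A by simp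
    moreover have "snd q1' \<noteq> snd q2" using snd_inj[OF D(4) E(3)] D(6) A(3) by auto
    ultimately have lt: "snd q1' < snd q2" by simp
    show False
    proof (cases "fst q1 \<le> k")
      case True
      then have "fst q1 < fst q1'" "fst q2 < fst q1'" using D(6) A(3) by auto
      then show False using narrow_step(1)[OF w D(1,2,5)] narrow_step(2)[OF w D(2) E(1) lt] A(4) by linarith
    next
      case False
      then have "fst q1' < fst q1" "fst q1' < fst q2" using D(6) A(3) by auto
      then show False using narrow_step(2)[OF w D(1,2,5)] narrow_step(1)[OF w D(2) E(1) lt] A(4) by linarith
    qed
  qed
  have "inj_on ?f (crossings X a k b)"
  proof (rule inj_onI)
    fix u v assume uv: "u \<in> crossings X a k b" "v \<in> crossings X a k b" "?f u = ?f v"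
    obtain q1 q1' where e1: "u = (q1, q1')" by (cases u)
    obtain q2 q2' where e2: "v = (q2, q2')" by (cases v)
    have A: "(q1, q1') \<in> crossings X a k b" "(q2, q2') \<in> crossings X a k b" using uv e1 e2 by simp_all
    have E: "(fst q1 \<le> k) = (fst q2 \<le> k)" "col q1 = col q2" using uv(3) e1 e2 by simp_all
    have "\<not> snd q1 < snd q2" using no[OF A E] by blast
    moreover have "\<not> snd q2 < snd q1" using no[OF A(2,1) E(1)[symmetric] E(2)[symmetric]] by blast
    ultimately have "q1 = q2" using snd_inj[OF crossingsD(3)[OF A(1)] crossingsD(3)[OF A(2)]] by simp
    then have "fst u = fst v" using e1 e2 by simp
    then show "u = v" by (rule inj_onD[OF crossings_inj_fst _ uv(1,2)])
  qed
  \<comment> \<open>So narrow a strip meets at most two columns; with the two sides this makes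
    4.\<close>
  moreover have "?f ` crossings X a k b \<subseteq> UNIV \<times> {?c, ?c + 1}"
  proof (rule image_subsetI)
    fix u assume u: "u \<in> crossings X a k b"
    obtain q q' where e: "u = (q, q')" by (cases u)
    have "q \<in> strip X a b" using u unfolding e by (rule crossingsD)
    then have q: "a + 1 \<le> fst q" "fst q \<le> a + 1 + int m" using w by (auto dest!: stripD)
    have "?c \<le> col q" unfolding col_def by (rule zdiv_mono1[OF q(1)]) (use m_pos in simp)
    moreover have "col q \<le> (a + 1 + int m) div int m"
      unfolding col_def by (rule zdiv_mono1[OF q(2)]) (use m_pos in simp)
    moreover have "(a + 1 + int m) div int m = ?c + 1" using m_pos by simp
    ultimately have "col q = ?c \<or> col q = ?c + 1" by linarith
    then show "?f u \<in> UNIV \<times> {?c, ?c + 1}" using e by simp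
  qed
  ultimately have "card (crossings X a k b) \<le> card ((UNIV :: bool set) \<times> {?c, ?c + 1})"
    by (intro card_inj_on_le) auto
  also have "\<dots> = 4" by (simp add: card_cartesian_product)
  finally show ?thesis .
qed

section \<open>Crossings and hitting sets\<close>

text \<open>Z is a hitting set for the left/right pairs inside a block, hence meets every block that has
  points on both sides of the line. A crossing between two blocks with no such points is charged to
  the residue class that moves across the line or enters the strip.\<close>
lemma crossings_le_hitting:
  assumes Z: "finite Z" "\<And>p q. p \<in> strip X a b \<Longrightarrow> q \<in> strip X a b \<Longrightarrow> fst p \<le> k \<Longrightarrow> k < fst q \<Longrightarrow> block p = block q
     \<Longrightarrow> p \<in> Z \<or> q \<in> Z"
    and ab: "a < k" "k < b"
  shows "int (card (crossings X a k b)) \<le> 4 * int (card Z) + 2 * min (int m) (min (k - a) (b - k))"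
proof -
  let ?C = "crossings X a k b"
  \<comment> \<open>The crossings are divided into those inside a block (\<open>C1\<close>), those
    leaving or entering a mixed block (\<open>C2\<close>, \<open>C3\<close>), and those between two
    unmixed blocks, going right (\<open>LR\<close>) or left (\<open>RL\<close>).\<close>
  define mixed where "mixed = {s. \<exists>p\<in>strip X a b. \<exists>q\<in>strip X a b. fst p \<le> k \<and> k < fst q \<and> block p = s \<and> block q = s}"
  define C1 where "C1 = {(q, q') \<in> ?C. block q = block q'}"
  define C2 where "C2 = {(q, q') \<in> ?C. block q \<noteq> block q' \<and> block q \<in> mixed}"
  define C3 where "C3 = {(q, q') \<in> ?C. block q \<noteq> block q' \<and> block q' \<in> mixed}"
  define LR where "LR = {(q, q') \<in> ?C. block q \<notin> mixed \<and> block q' \<notin> mixed \<and> fst q \<le> k}"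
  define RL where "RL = {(q, q') \<in> ?C. block q \<notin> mixed \<and> block q' \<notin> mixed \<and> k < fst q}"
  have mixedI: "block p \<in> mixed" if "p \<in> strip X a b" "q \<in> strip X a b" "fst p \<le> k" "k < fst q" "block p = block q" for p q
    unfolding mixed_def using that by auto
  have finC: "finite Y" if "Y \<subseteq> ?C" for Y using finite_crossings that by (rule rev_finite_subset)
  have sub: "C1 \<subseteq> ?C" "C2 \<subseteq> ?C" "C3 \<subseteq> ?C" "LR \<subseteq> ?C" "RL \<subseteq> ?C"
    by (auto simp: C1_def C2_def C3_def LR_def RL_def)
  have injf: "inj_on fst Y" and injs: "inj_on snd Y" if "Y \<subseteq> ?C" for Y
    using crossings_inj_fst crossings_inj_snd that inj_on_subset by blast+
  have blk: "block q < block q'" if "(q, q') \<in> ?C" "block q \<noteq> block q'" for q q'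
    using crossingsD(5)[OF that(1)] block_mono[of q q'] that(2) by simp
  have mixedZ: "mixed \<subseteq> block ` Z" 
  proof
    fix s assume "s \<in> mixed"
    then obtain p q where pq: "p \<in> strip X a b" "q \<in> strip X a b" "fst p \<le> k" "k < fst q" "block p = s" "block q = s"
      unfolding mixed_def by blast
    have "p \<in> Z \<or> q \<in> Z" using Z(2)[OF pq(1-4)] pq(5,6) by simp
    then show "s \<in> block ` Z" using pq(5,6) by (elim disjE) (auto intro: image_eqI[rotated])
  qed
  then have finM: "finite mixed" and cardM: "card mixed \<le> card Z"
    using Z(1) by (auto intro: finite_subset surj_card_le)
  \<comment> \<open>Some end lies in \<open>Z\<close>, and a point is the lower end of at most one
    crossing and the upper end of at most one.\<close>
  have c1: "card C1 \<le> 2 * card Z"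
  proof -
    have "C1 \<subseteq> {u\<in>C1. fst u \<in> Z} \<union> {u\<in>C1. snd u \<in> Z}"
    proof
      fix u assume u: "u \<in> C1"
      obtain q q' where e: "u = (q, q')" by (cases u)
      then have A: "(q, q') \<in> ?C" "block q = block q'" using u by (auto simp: C1_def)
      have "q \<in> Z \<or> q' \<in> Z"
        using crossingsD(6)[OF A(1)] Z(2)[OF crossingsD(1,2)[OF A(1)]] Z(2)[OF crossingsD(2,1)[OF A(1)]] A(2) by force
      then show "u \<in> {u\<in>C1. fst u \<in> Z} \<union> {u\<in>C1. snd u \<in> Z}" using u e by auto
    qed
    then have "card C1 \<le> card {u\<in>C1. fst u \<in> Z} + card {u\<in>C1. snd u \<in> Z}"
      by (intro order_trans[OF card_mono card_Un_le]) (use finC[OF sub(1)] in auto)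
    moreover have "card {u\<in>C1. fst u \<in> Z} \<le> card Z"
      by (rule card_inj_on_le[of fst]) (use Z(1) sub(1) in \<open>auto intro: injf\<close>)
    moreover have "card {u\<in>C1. snd u \<in> Z} \<le> card Z"
      by (rule card_inj_on_le[of snd]) (use Z(1) sub(1) in \<open>auto intro: injs\<close>)
    ultimately show ?thesis by simp
  qed
  \<comment> \<open>Only the highest strip point of a block can start a crossing that leaves the
    block, so there is at most one per mixed block. For \<open>C3\<close> the lowest strip point
    takes this role.\<close>
  have c2: "card C2 \<le> card Z"
  proof -
    have "inj_on (\<lambda>u. block (fst u)) C2"
    proof (rule inj_onI)
      fix u v assume uv: "u \<in> C2" "v \<in> C2" "block (fst u) = block (fst v)"
      obtain q1 q1' where e1: "u = (q1, q1')" by (cases u)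
      obtain q2 q2' where e2: "v = (q2, q2')" by (cases v)
      note e = e1 e2
      have A0: "(q1, q1') \<in> ?C" "(q2, q2') \<in> ?C" "block q1 \<noteq> block q1'" "block q2 \<noteq> block q2'" "block q1 = block q2"
        using uv e by (auto simp: C2_def)
      note A = A0(1,2) blk[OF A0(1,3)] blk[OF A0(2,4)] A0(5)
      have "\<not> snd q1 < snd q2" "\<not> snd q2 < snd q1"
        using crossingsD(7)[OF A(1) crossingsD(1)[OF A(2)]] crossingsD(7)[OF A(2) crossingsD(1)[OF A(1)]]
          block_mono[of q1' q2] block_mono[of q2' q1] A by auto
      then have "q1 = q2" using snd_inj[OF crossingsD(3)[OF A(1)] crossingsD(3)[OF A(2)]] by simp
      then show "u = v" using inj_onD[OF injf[OF sub(2)], of u v] uv e by simp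
    qed
    moreover have "(\<lambda>u. block (fst u)) ` C2 \<subseteq> mixed" by (auto simp: C2_def)
    ultimately have "card C2 \<le> card mixed" using finM by (rule card_inj_on_le)
    then show ?thesis using cardM by simp
  qed
  have c3: "card C3 \<le> card Z"
  proof -
    have "inj_on (\<lambda>u. block (snd u)) C3"
    proof (rule inj_onI)
      fix u v assume uv: "u \<in> C3" "v \<in> C3" "block (snd u) = block (snd v)"
      obtain q1 q1' where e1: "u = (q1, q1')" by (cases u)
      obtain q2 q2' where e2: "v = (q2, q2')" by (cases v)
      note e = e1 e2
      have A0: "(q1, q1') \<in> ?C" "(q2, q2') \<in> ?C" "block q1 \<noteq> block q1'" "block q2 \<noteq> block q2'" "block q1' = block q2'"
        using uv e by (auto simp: C3_def)
      note A = A0(1,2) blk[OF A0(1,3)] blk[OF A0(2,4)] A0(5)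
      have "\<not> snd q1' < snd q2'" "\<not> snd q2' < snd q1'"
        using crossingsD(8)[OF A(2) crossingsD(2)[OF A(1)]] crossingsD(8)[OF A(1) crossingsD(2)[OF A(2)]]
          block_mono[of q1' q2] block_mono[of q2' q1] A by auto
      then have "q1' = q2'" using snd_inj[OF crossingsD(4)[OF A(1)] crossingsD(4)[OF A(2)]] by simp
      then show "u = v" using inj_onD[OF injs[OF sub(3)], of u v] uv e by simp
    qed
    moreover have "(\<lambda>u. block (snd u)) ` C3 \<subseteq> mixed" by (auto simp: C3_def)
    ultimately have "card C3 \<le> card mixed" using finM by (rule card_inj_on_le)
    then show ?thesis using cardM by simp
  qed
  have width: "int (card Y) \<le> v - u" if "Y \<subseteq> strip X a b" "\<And>p. p \<in> Y \<Longrightarrow> u < fst p \<and> fst p \<le> v" "u < v" for Y u v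
  proof -
    have "card Y \<le> card {u<..v}"
      by (rule card_inj_on_le[OF inj_on_subset[OF inj_fst_strip that(1)]]) (use that(2) in auto)
    then show ?thesis using that(3) by simp
  qed
  \<comment> \<open>All ends on one side of the line are distinct points with distinct
    x-coordinates, so the width of either half bounds the number of crossings.\<close>
  have width_pairs: "int (card Y) \<le> min (k - a) (b - k)" if Y: "Y \<subseteq> ?C" and
      s: "(\<forall>u\<in>Y. fst (fst u) \<le> k) \<or> (\<forall>u\<in>Y. k < fst (fst u))" for Y
  proof -
    have cf: "card (fst ` Y) = card Y" "card (snd ` Y) = card Y" using injf[OF Y] injs[OF Y] by (auto simp: card_image)
    have st: "fst ` Y \<subseteq> strip X a b" "snd ` Y \<subseteq> strip X a b" using Y crossingsD(1,2) by fastforce+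
    have sd: "(fst (fst u) \<le> k) \<noteq> (fst (snd u) \<le> k)" if "u \<in> Y" for u
      using crossingsD(6)[of "fst u" "snd u" a k b] Y that by auto
    show ?thesis using s
    proof
      assume l: "\<forall>u\<in>Y. fst (fst u) \<le> k"
      have "int (card (fst ` Y)) \<le> k - a"
        by (rule width[OF st(1)]) (use l st(1) ab in \<open>auto dest!: stripD\<close>)
      moreover have "int (card (snd ` Y)) \<le> b - k"
        by (rule width[OF st(2)]) (use l sd st(2) ab in \<open>force dest!: stripD\<close>)+
      ultimately show ?thesis using cf by simp
    next
      assume l: "\<forall>u\<in>Y. k < fst (fst u)"
      have "int (card (fst ` Y)) \<le> b - k"
        by (rule width[OF st(1)]) (use l st(1) ab in \<open>auto dest!: stripD\<close>)
      moreover have "int (card (snd ` Y)) \<le> k - a"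
        by (rule width[OF st(2)]) (use l sd st(2) ab in \<open>force dest!: stripD\<close>)+
      ultimately show ?thesis using cf by simp
    qed
  qed
  \<comment> \<open>By \<open>full\<close> the class of \<open>p\<close> and \<open>q\<close> has a
    point in block \<open>s\<close>. Within a class x grows with the block, so this point lies
    between \<open>p\<close> and \<open>q\<close> horizontally, left of the line and in the strip;
    with \<open>r\<close> it makes the block mixed.\<close>
  have between: "s \<in> mixed" if "p \<in> strip X a b" "q \<in> strip X a b" "cls p = cls q" "fst p \<le> k" "fst q \<le> k"
      "block p \<le> s" "s \<le> block q" "r \<in> strip X a b" "k < fst r" "block r = s" for p q r s
  proof -
    have X: "p \<in> X" "q \<in> X" using that(1,2) stripD by blast+
    from block_full[OF X that(3,6,7)]
    obtain z where z: "z \<in> X" "block z = s" "cls z = cls p" .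
    have "fst p \<le> fst z" "fst z \<le> fst q" using fst_mono X z that by auto
    then have "z \<in> strip X a b" "fst z \<le> k" using z that by (auto simp: strip_def)
    then show ?thesis using mixedI[of z r] that z by auto
  qed
  \<comment> \<open>The left ends, here the lower points, have distinct classes: a repetition would
    enclose the unmixed block of \<open>q1'\<close> between two left points of one class.\<close>
  have lr: "card LR \<le> m"
  proof -
    have no: False if A: "(q1, q1') \<in> LR" "(q2, q2') \<in> LR" "cls q1 = cls q2" "snd q1 < snd q2" for q1 q1' q2 q2'
    proof -
      have C: "(q1, q1') \<in> ?C" "(q2, q2') \<in> ?C" "block q1' \<notin> mixed" "fst q1 \<le> k" "fst q2 \<le> k"
        using A by (auto simp: LR_def)
      have "snd q1' \<le> snd q2" using crossingsD(7)[OF C(1) crossingsD(1)[OF C(2)]] A(4) by simp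
      then have "block q1 \<le> block q1'" "block q1' \<le> block q2" using crossingsD(5)[OF C(1)] block_mono by auto
      moreover have "k < fst q1'" using crossingsD(6)[OF C(1)] C(4) by auto
      ultimately show False
        using between[OF crossingsD(1)[OF C(1)] crossingsD(1)[OF C(2)] A(3) C(4,5) _ _ crossingsD(2)[OF C(1)]] C(3) by blast
    qed
    have "inj_on (\<lambda>u. cls (fst u)) LR"
    proof (rule inj_onI)
      fix u v assume uv: "u \<in> LR" "v \<in> LR" "cls (fst u) = cls (fst v)"
      have "snd (fst u) = snd (fst v)"
        using no[of "fst u" "snd u" "fst v" "snd v"] no[of "fst v" "snd v" "fst u" "snd u"] uv by force
      moreover have "fst u \<in> X" "fst v \<in> X"
        using crossingsD(3)[of "fst u" "snd u" a k b] crossingsD(3)[of "fst v" "snd v" a k b] subsetD[OF sub(4)] uv(1,2) by simp_all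
      ultimately have "fst u = fst v" using snd_inj by blast
      then show "u = v" using inj_onD[OF injf[OF sub(4)]] uv by blast
    qed
    then have "card LR \<le> card {..<m}" by (rule card_inj_on_le) (auto simp: cls_less)
    then show ?thesis by simp
  qed
  \<comment> \<open>Now the left ends are the upper points, and the enclosed block is that of
    \<open>q2\<close>.\<close>
  have rl: "card RL \<le> m"
  proof -
    have no: False if A: "(q1, q1') \<in> RL" "(q2, q2') \<in> RL" "cls q1' = cls q2'" "snd q1 < snd q2" for q1 q1' q2 q2'
    proof -
      have C: "(q1, q1') \<in> ?C" "(q2, q2') \<in> ?C" "block q2 \<notin> mixed" "k < fst q1" "k < fst q2"
        using A by (auto simp: RL_def)
      have "snd q1' \<le> snd q2" using crossingsD(7)[OF C(1) crossingsD(1)[OF C(2)]] A(4) by simp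
      then have "block q1' \<le> block q2" "block q2 \<le> block q2'" using crossingsD(5)[OF C(2)] block_mono by auto
      moreover have "fst q1' \<le> k" "fst q2' \<le> k" using crossingsD(6)[OF C(1)] crossingsD(6)[OF C(2)] C(4,5) by auto
      ultimately show False
        using between[OF crossingsD(2)[OF C(1)] crossingsD(2)[OF C(2)] A(3) _ _ _ _ crossingsD(1)[OF C(2)] C(5)] C(3) by blast
    qed
    have "inj_on (\<lambda>u. cls (snd u)) RL"
    proof (rule inj_onI)
      fix u v assume uv: "u \<in> RL" "v \<in> RL" "cls (snd u) = cls (snd v)"
      have "snd (fst u) = snd (fst v)"
        using no[of "fst u" "snd u" "fst v" "snd v"] no[of "fst v" "snd v" "fst u" "snd u"] uv by force
      moreover have "fst u \<in> X" "fst v \<in> X"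
        using crossingsD(3)[of "fst u" "snd u" a k b] crossingsD(3)[of "fst v" "snd v" a k b] subsetD[OF sub(5)] uv(1,2) by simp_all
      ultimately have "fst u = fst v" using snd_inj by blast
      then show "u = v" using inj_onD[OF injf[OF sub(5)]] uv by blast
    qed
    then have "card RL \<le> card {..<m}" by (rule card_inj_on_le) (auto simp: cls_less)
    then show ?thesis by simp
  qed
  have wlr: "int (card LR) \<le> min (k - a) (b - k)" by (rule width_pairs[OF sub(4)]) (auto simp: LR_def)
  have wrl: "int (card RL) \<le> min (k - a) (b - k)" by (rule width_pairs[OF sub(5)]) (auto simp: RL_def)
  have "?C \<subseteq> C1 \<union> (C2 \<union> (C3 \<union> (LR \<union> RL)))"
    by (auto simp: C1_def C2_def C3_def LR_def RL_def)
  then have "card ?C \<le> card (C1 \<union> (C2 \<union> (C3 \<union> (LR \<union> RL))))"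
    by (rule card_mono[rotated]) (use finC sub in auto)
  also have "\<dots> \<le> card C1 + (card C2 + (card C3 + (card LR + card RL)))"
    by (meson add_mono card_Un_le le_refl le_trans)
  also have "\<dots> \<le> 4 * card Z + (card LR + card RL)" using c1 c2 c3 by linarith
  finally have "int (card ?C) \<le> 4 * int (card Z) + (int (card LR) + int (card RL))" by linarith
  moreover have "int (card LR) \<le> min (int m) (min (k - a) (b - k))" using lr wlr by simp
  moreover have "int (card RL) \<le> min (int m) (min (k - a) (b - k))" using rl wrl by simp
  moreover have "c \<le> z + 2 * M" if "c \<le> z + (l + r)" "l \<le> M" "r \<le> M" for c z l r M :: int
    using that by linarith
  ultimately show ?thesis by blast
qed

section \<open>Small hitting sets in wide strips\<close>

lemma same_block_gap:
  assumes X: "p \<in> X" "q \<in> X" and bl: "block p = block q" and lt: "fst p < fst q"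
  shows "cls p < cls q" "4 * int m * 2 ^ cls q \<le> fst q - fst p"
proof -
  show c: "cls p < cls q"
  proof (rule ccontr)
    assume n: "\<not> cls p < cls q"
    then have "(2::int) ^ (cls q + 3) \<le> 2 ^ (cls p + 3)" by (intro power_increasing) auto
    then have "col q \<le> col p" using col_eq[OF X(1)] col_eq[OF X(2)] bl by linarith
    then have "int m * col q \<le> int m * col p" by (rule mult_left_mono) simp
    then show False using lt n fst_eq[of p] fst_eq[of q] by linarith
  qed
  \<comment> \<open>The shift by 3 in the exponent leaves at least
    \<open>2 ^ (cls q + 3) - 2 ^ (cls q + 2) = 4 * 2 ^ cls q\<close> columns between the
    points.\<close>
  have "(2::int) ^ (cls p + 3) \<le> 2 ^ (cls q + 2)" using c by (intro power_increasing) auto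
  then have "col p + 4 * 2 ^ cls q \<le> col q"
    using col_eq[OF X(1)] col_eq[OF X(2)] bl by (simp add: power_add)
  then have "int m * (col p + 4 * 2 ^ cls q) \<le> int m * col q" by (rule mult_left_mono) simp
  then show "4 * int m * 2 ^ cls q \<le> fst q - fst p"
    using c fst_eq[of p] fst_eq[of q] by (simp add: distrib_left mult.assoc mult.left_commute)
qed

definition right_mixed :: "int \<Rightarrow> int \<Rightarrow> int \<Rightarrow> point set" where
  "right_mixed a k b = {q \<in> strip X a b. k < fst q \<and> (\<exists>p\<in>strip X a b. fst p \<le> k \<and> block p = block q)}"

definition left_mixed :: "int \<Rightarrow> int \<Rightarrow> int \<Rightarrow> point set" where
  "left_mixed a k b = {p \<in> strip X a b. fst p \<le> k \<and> (\<exists>q\<in>strip X a b. k < fst q \<and> block p = block q)}"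

lemma card_le_blocks:
  assumes "Y \<subseteq> X" "\<And>p. p \<in> Y \<Longrightarrow> cls p = i" "\<And>p. p \<in> Y \<Longrightarrow> u \<le> block p \<and> block p < v" "u \<le> v"
  shows "int (card Y) \<le> v - u"
proof -
  have "inj_on block Y" by (rule inj_onI) (use assms(1,2) point_eqI in blast)
  then have "card Y \<le> card {u..<v}" by (rule card_inj_on_le) (use assms(3) in auto)
  then show ?thesis using assms(4) by simp
qed

text \<open>The column of a right point is at least \<open>k div m\<close> and that of its left
  partner at most \<open>k div m\<close>, so the block is one of the last \<open>8 * 2 ^ i\<close>
  values below \<open>k div m\<close>. The last bound counts the base points
  \<open>m * block\<close> in (a, k], as a class has at most one point per block.\<close>

lemma right_mixed_bounds:
  assumes ab: "a < k" "k < b"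
  defines "Y i \<equiv> {q \<in> right_mixed a k b. cls q = i}"
  shows "int (card (Y i)) \<le> res_count m i k b" "int (card (Y i)) \<le> 8 * 2 ^ i"
    "Y i \<noteq> {} \<Longrightarrow> 4 * int m * 2 ^ i \<le> b - a"
    "int (card {q \<in> Y i. a < int m * block q}) \<le> res_count m 0 a k"
proof -
  have Ys: "Y i \<subseteq> strip X a b" by (auto simp: Y_def right_mixed_def)
  then have YX: "Y i \<subseteq> X" by (auto dest: stripD)
  have Yc: "cls q = i" if "q \<in> Y i" for q using that by (simp add: Y_def)
  have bl: "k div int m - 8 * 2 ^ i \<le> block q \<and> block q < k div int m" "4 * int m * 2 ^ i \<le> b - a"
    if q: "q \<in> Y i" for q
  proof -
    obtain p where p: "p \<in> strip X a b" "fst p \<le> k" "block p = block q"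
      using q by (auto simp: Y_def right_mixed_def)
    have k: "k < fst q" "q \<in> strip X a b" using q by (auto simp: Y_def right_mixed_def)
    have X: "p \<in> X" "q \<in> X" using p k stripD by blast+
    have "col p \<le> k div int m" "k div int m \<le> col q"
      unfolding col_def using p k m_pos by (auto intro!: zdiv_mono1)
    moreover have "(0::int) < 2 ^ (cls p + 3)" by simp
    moreover have "col q = block q + 8 * 2 ^ i" using col_eq[OF X(2)] Yc[OF q] by (simp add: power_add)
    ultimately show "k div int m - 8 * 2 ^ i \<le> block q \<and> block q < k div int m"
      using col_eq[OF X(1)] p(3) by linarith
    have "fst p < fst q" using p k by linarith
    then have "4 * int m * 2 ^ i \<le> fst q - fst p" using same_block_gap(2)[OF X p(3)] Yc[OF q] by simp
    then show "4 * int m * 2 ^ i \<le> b - a" using stripD[OF p(1)] stripD[OF k(2)] by linarith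
  qed
  show "4 * int m * 2 ^ i \<le> b - a" if "Y i \<noteq> {}" using bl(2) that by blast
  have "int (card (Y i)) \<le> k div int m - (k div int m - 8 * 2 ^ i)"
    by (rule card_le_blocks[OF YX Yc bl(1)]) auto
  then show "int (card (Y i)) \<le> 8 * 2 ^ i" by simp
  show "int (card (Y i)) \<le> res_count m i k b"
  proof (rule card_res_class[OF m_pos])
    show "inj_on fst (Y i)" using inj_fst_strip Ys by (rule inj_on_subset)
    show "fst q mod int m = int i \<and> k < fst q \<and> fst q \<le> b" if "q \<in> Y i" for q
      using that by (auto simp: Y_def right_mixed_def strip_def int_cls)
  qed (use ab in simp)
  have "int (card {q \<in> Y i. a < int m * block q}) \<le> (k div int m + 1) - (a div int m + 1)"
  proof (rule card_le_blocks[of _ i])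
    fix q assume q: "q \<in> {q \<in> Y i. a < int m * block q}"
    have "int m * (a div int m) \<le> a"
      using m_pos pos_mod_sign[of "int m" a] mult_div_mod_eq[of "int m" a] by linarith
    then have "int m * (a div int m) < int m * block q" using q by simp
    then have "a div int m < block q" using m_pos by simp
    then show "a div int m + 1 \<le> block q \<and> block q < k div int m + 1" using bl(1)[of q] q by auto
  qed (use YX Yc ab m_pos in \<open>auto intro: zdiv_mono1\<close>)
  then show "int (card {q \<in> Y i. a < int m * block q}) \<le> res_count m 0 a k" by (simp add: res_count_def)
qed

text \<open>A strip point whose base is not right of \<open>a\<close> has its block between
  \<open>a div m - 8 * 2 ^ i\<close> and \<open>a div m\<close>, which leaves
  \<open>8 * 2 ^ i + 1 <= 9 * 2 ^ i\<close> values. The width bound comes from the right partner,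
  whose class is larger.\<close>

lemma left_mixed_bounds:
  assumes ab: "a < k" "k < b"
  defines "Y i \<equiv> {p \<in> left_mixed a k b. cls p = i \<and> int m * block p \<le> a}"
  shows "int (card (Y i)) \<le> res_count m i a k" "int (card (Y i)) \<le> 9 * 2 ^ i"
    "Y i \<noteq> {} \<Longrightarrow> 4 * int m * 2 ^ i \<le> b - a"
proof -
  have Ys: "Y i \<subseteq> strip X a b" by (auto simp: Y_def left_mixed_def)
  then have YX: "Y i \<subseteq> X" by (auto dest: stripD)
  have Yc: "cls q = i" if "q \<in> Y i" for q using that by (simp add: Y_def)
  have gap: "4 * int m * 2 ^ i \<le> b - a" if p: "p \<in> Y i" for p
  proof -
    obtain q where q: "q \<in> strip X a b" "k < fst q" "block p = block q"
      using p by (auto simp: Y_def left_mixed_def)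
    have k: "fst p \<le> k" "p \<in> strip X a b" using p by (auto simp: Y_def left_mixed_def)
    have X: "p \<in> X" "q \<in> X" using q k stripD by blast+
    have "fst p < fst q" using q k by linarith
    then have "4 * int m * 2 ^ cls q \<le> fst q - fst p" "i < cls q"
      using same_block_gap[OF X q(3)] Yc[OF p] by simp_all
    moreover have "4 * int m * 2 ^ i \<le> 4 * int m * 2 ^ cls q"
      using \<open>i < cls q\<close> by (intro mult_left_mono power_increasing) auto
    ultimately show ?thesis using stripD[OF q(1)] stripD[OF k(2)] by linarith
  qed
  show "4 * int m * 2 ^ i \<le> b - a" if "Y i \<noteq> {}" using gap that by blast
  have bl: "a div int m - 8 * 2 ^ i \<le> block p \<and> block p < a div int m + 1" if p: "p \<in> Y i" for p
  proof -
    have "block p * int m \<le> a" using p by (simp add: Y_def mult.commute)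
    then have "block p * int m div int m \<le> a div int m" using m_pos by (intro zdiv_mono1) auto
    then have "block p \<le> a div int m" using m_pos by simp
    moreover have "a div int m \<le> col p"
      unfolding col_def using p Ys stripD[of p a b] m_pos by (intro zdiv_mono1) auto
    moreover have "col p = block p + 8 * 2 ^ i" using col_eq[of p] YX p Yc[OF p] by (auto simp: power_add)
    ultimately show ?thesis by linarith
  qed
  have "int (card (Y i)) \<le> a div int m + 1 - (a div int m - 8 * 2 ^ i)"
  proof (rule card_le_blocks[OF YX Yc bl])
    have "(0::int) \<le> 8 * 2 ^ i" by simp
    then show "a div int m - 8 * 2 ^ i \<le> a div int m + 1" by linarith
  qed
  moreover have "(1::int) \<le> 2 ^ i" by simp
  ultimately show "int (card (Y i)) \<le> 9 * 2 ^ i" by linarith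
  show "int (card (Y i)) \<le> res_count m i a k"
  proof (rule card_res_class[OF m_pos])
    show "inj_on fst (Y i)" using inj_fst_strip Ys by (rule inj_on_subset)
    show "fst p mod int m = int i \<and> a < fst p \<and> fst p \<le> k" if "p \<in> Y i" for p
      using that by (auto simp: Y_def left_mixed_def strip_def int_cls)
  qed (use ab in simp)
qed

text \<open>Residue 0 accounts for the blocks whose base point m * block lies in the interval.\<close>
definition weight :: "nat \<Rightarrow> int \<Rightarrow> int \<Rightarrow> int" where
  "weight i a b = res_count m 0 a b + res_count m i a b"

lemma weight_add: "weight i a k + weight i k b = weight i a b"
  unfolding weight_def using res_count_add[of m 0 a k b] res_count_add[of m i a k b] by linarith

lemma weight_nonneg: "a \<le> b \<Longrightarrow> 0 \<le> weight i a b"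
  unfolding weight_def using res_count_nonneg[OF m_pos, of a b] by (simp add: add_nonneg_nonneg)

lemma weight_ge: "int m * q \<le> b - a \<Longrightarrow> 2 * q \<le> weight i a b"
  unfolding weight_def using res_count_ge[OF m_pos, of q b a] by (metis add_mono mult_2)

text \<open>The two residue counts lose at most 1 each, and a width of at least \<open>2 * m\<close>
  makes the weight at least 4, which absorbs this.\<close>

lemma weight_le_twice:
  assumes "b - a \<le> b' - a'" "2 * int m \<le> b' - a'"
  shows "weight i a b \<le> 2 * weight i a' b'"
proof -
  have "4 \<le> weight i a' b'" using weight_ge[of 2 b' a' i] assms(2) by (simp add: mult.commute)
  moreover have "weight i a b \<le> weight i a' b' + 2"
    unfolding weight_def using res_count_le_Suc[OF m_pos assms(1), of 0] res_count_le_Suc[OF m_pos assms(1), of i] by linarith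
  ultimately show ?thesis by linarith
qed

text \<open>The cut-off is the distance forced by \<open>same_block_gap\<close>; in a narrower strip
  class \<open>i\<close> contributes nothing to the hitting set.\<close>

definition node_cost :: "nat \<Rightarrow> int \<Rightarrow> int \<Rightarrow> int \<Rightarrow> int" where
  "node_cost i a k b = (if 4 * int m * 2 ^ i \<le> b - a then min (2 ^ i) (min (weight i a k) (weight i k b)) else 0)"

lemma node_cost_nonneg: "a < k \<Longrightarrow> k < b \<Longrightarrow> 0 \<le> node_cost i a k b"
  by (simp add: node_cost_def weight_nonneg)

lemma wide: "4 * int m * 2 ^ i \<le> b - a \<Longrightarrow> 4 * int m \<le> b - a"
proof -
  have "4 * int m * 1 \<le> 4 * int m * 2 ^ i" by (rule mult_left_mono) auto
  then show "4 * int m * 2 ^ i \<le> b - a \<Longrightarrow> 4 * int m \<le> b - a" by linarith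
qed

lemma card_le_sum_classes:
  assumes "finite Z" "\<And>i. i < m \<Longrightarrow> int (card {p \<in> Z. cls p = i}) \<le> f i"
  shows "int (card Z) \<le> (\<Sum>i<m. f i)"
proof -
  have "card Z = card (\<Union>i<m. {p \<in> Z. cls p = i})"
    by (rule arg_cong[where f = card]) (use cls_less in auto)
  also have "\<dots> \<le> (\<Sum>i<m. card {p \<in> Z. cls p = i})" by (rule card_UN_le) simp
  finally have "int (card Z) \<le> (\<Sum>i<m. int (card {p \<in> Z. cls p = i}))" by (simp flip: of_nat_sum)
  also have "\<dots> \<le> (\<Sum>i<m. f i)" by (rule sum_mono) (use assms(2) in simp)
  finally show ?thesis .
qed

text \<open>The hitting set is taken on the narrower side of the line. On the left this fails for blocks
  based inside the strip, which can have many points there; those are charged on the right, and there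
  are few such blocks.\<close>
lemma hitting_set:
  assumes ab: "a < k" "k < b"
  obtains Z where "finite Z"
    "\<And>p q. p \<in> strip X a b \<Longrightarrow> q \<in> strip X a b \<Longrightarrow> fst p \<le> k \<Longrightarrow> k < fst q \<Longrightarrow> block p = block q \<Longrightarrow> p \<in> Z \<or> q \<in> Z"
    "int (card Z) \<le> 34 * (\<Sum>i<m. node_cost i a k b)"
proof (cases "b - k \<le> k - a")
  case True
  let ?Z = "right_mixed a k b"
  have fz: "finite ?Z" by (simp add: right_mixed_def finite_strip)
  have "int (card {p \<in> ?Z. cls p = i}) \<le> 34 * node_cost i a k b" for i
  proof (cases "{p \<in> ?Z. cls p = i} = {}")
    case False
    note rel = right_mixed_bounds(3)[OF ab False]
    \<comment> \<open>A strip of width at least \<open>4 * m\<close> has a wider side of at least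
      \<open>2 * m\<close>, so the weight of the narrower side is controlled by that of the wider
      one.\<close>
    have "2 * int m \<le> k - a" using wide[OF rel] True by linarith
    then have "weight i k b \<le> 2 * weight i a k" by (rule weight_le_twice[OF True])
    moreover have "res_count m i k b \<le> weight i k b"
      unfolding weight_def using res_count_nonneg[OF m_pos, of k b 0] ab by simp
    ultimately show ?thesis
      using right_mixed_bounds(1,2)[OF ab, of i] rel weight_nonneg[of a k i] ab by (simp add: node_cost_def)
  next
    case e: True
    show ?thesis unfolding e using node_cost_nonneg[OF ab, of i] by simp
  qed
  then have "int (card ?Z) \<le> (\<Sum>i<m. 34 * node_cost i a k b)" by (intro card_le_sum_classes[OF fz])
  then show ?thesis by (intro that[OF fz]) (auto simp: right_mixed_def sum_distrib_left)
next
  case False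
  let ?Z1 = "{q \<in> right_mixed a k b. a < int m * block q}" and ?Z2 = "{p \<in> left_mixed a k b. int m * block p \<le> a}"
  have fz: "finite (?Z1 \<union> ?Z2)" by (simp add: right_mixed_def left_mixed_def finite_strip)
  have "int (card {p \<in> ?Z1 \<union> ?Z2. cls p = i}) \<le> 34 * node_cost i a k b" for i
  proof (cases "{p \<in> ?Z1 \<union> ?Z2. cls p = i} = {}")
    case ne: False
    let ?R = "{q \<in> right_mixed a k b. cls q = i}" and ?L = "{p \<in> left_mixed a k b. cls p = i \<and> int m * block p \<le> a}"
    have "?R \<noteq> {} \<or> ?L \<noteq> {}" using ne by blast
    then have rel: "4 * int m * 2 ^ i \<le> b - a" using right_mixed_bounds(3)[OF ab] left_mixed_bounds(3)[OF ab] by blast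
    have le: "k - a \<le> b - k" using False by linarith
    have "2 * int m \<le> b - k" using wide[OF rel] le by linarith
    then have w: "weight i a k \<le> 2 * weight i k b" by (rule weight_le_twice[OF le])
    have "{p \<in> ?Z1 \<union> ?Z2. cls p = i} = {q \<in> ?R. a < int m * block q} \<union> ?L" by auto
    then have "card {p \<in> ?Z1 \<union> ?Z2. cls p = i} \<le> card {q \<in> ?R. a < int m * block q} + card ?L"
      by (simp only: card_Un_le)
    moreover have "card {q \<in> ?R. a < int m * block q} \<le> card ?R"
      by (rule card_mono) (auto simp: right_mixed_def finite_strip)
    \<comment> \<open>The base points bound \<open>?Z1\<close> and the residue \<open>i\<close>
      bounds \<open>?Z2\<close>; together they form the weight. The 17 is \<open>8 + 9\<close>, and
      34 also covers the factor 2 between the weights.\<close>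
    ultimately have "int (card {p \<in> ?Z1 \<union> ?Z2. cls p = i}) \<le> weight i a k"
      "int (card {p \<in> ?Z1 \<union> ?Z2. cls p = i}) \<le> 17 * 2 ^ i"
      using right_mixed_bounds(2,4)[OF ab, of i] left_mixed_bounds(1,2)[OF ab, of i]
      unfolding weight_def by linarith+
    then show ?thesis using w rel weight_nonneg[of a k i] weight_nonneg[of k b i] ab by (simp add: node_cost_def)
  next
    case e: True
    show ?thesis unfolding e using node_cost_nonneg[OF ab, of i] by simp
  qed
  then have "int (card (?Z1 \<union> ?Z2)) \<le> (\<Sum>i<m. 34 * node_cost i a k b)" by (intro card_le_sum_classes[OF fz])
  then show ?thesis
    by (intro that[OF fz]) (auto simp: right_mixed_def left_mixed_def sum_distrib_left)
qed

section \<open>The potential of a strip\<close>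

text \<open>The first term pays 4 for each of the \<open>b - a - 1\<close> lines inside, as narrow
  strips require; the second pays for crossings between unmixed blocks; the third pays for the
  hitting set, with \<open>136 = 4 * 34\<close>.\<close>

definition strip_pot :: "int \<Rightarrow> int \<Rightarrow> int" where
  "strip_pot a b = 4 * (b - a - 1) + 2 * pot (int m) (b - a) + 136 * (\<Sum>i<m. pot (2 ^ i) (weight i a b))"

lemma crossings_le_strip_pot:
  assumes ab: "a < k" "k < b"
  shows "int (card (crossings X a k b)) + strip_pot a k + strip_pot k b \<le> strip_pot a b"
proof -
  let ?S = "\<lambda>a b. \<Sum>i<m. pot (2 ^ i) (weight i a b)" and ?N = "\<Sum>i<m. node_cost i a k b"
  have "node_cost i a k b + pot (2 ^ i) (weight i a k) + pot (2 ^ i) (weight i k b) \<le> pot (2 ^ i) (weight i a b)" for i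
  proof (cases "4 * int m * 2 ^ i \<le> b - a")
    case True
    \<comment> \<open>The width makes the weight at least \<open>8 * 2 ^ i\<close>, so the threshold
      in \<open>pot_split\<close> is reached.\<close>
    have "2 * (4 * 2 ^ i) \<le> weight i a b" by (rule weight_ge) (use True in \<open>simp add: mult_ac\<close>)
    moreover have "(0::int) \<le> 2 ^ i" by simp
    ultimately have "2 ^ i \<le> weight i a k + weight i k b" unfolding weight_add by linarith
    then show ?thesis
      using pot_split[of "weight i a k" "weight i k b" "2 ^ i"] True weight_nonneg ab
      by (simp add: node_cost_def weight_add)
  next
    case False
    then show ?thesis
      using pot_mono_split[of "weight i a k" "weight i k b" "2 ^ i"] weight_nonneg ab
      by (simp add: node_cost_def weight_add)
  qed
  then have "(\<Sum>i<m. node_cost i a k b + pot (2 ^ i) (weight i a k) + pot (2 ^ i) (weight i k b)) \<le> ?S a b"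
    by (intro sum_mono)
  then have S: "?N + ?S a k + ?S k b \<le> ?S a b" by (simp add: sum.distrib)
  have N0: "0 \<le> ?N" by (rule sum_nonneg) (rule node_cost_nonneg[OF ab])
  show ?thesis
  proof (cases "b - a \<le> int m")
    case True
    have "pot (int m) (k - a) + pot (int m) (b - k) \<le> pot (int m) ((k - a) + (b - k))"
      by (rule pot_mono_split) (use ab in auto)
    then have "pot (int m) (k - a) + pot (int m) (b - k) \<le> pot (int m) (b - a)" by simp
    moreover have "int (card (crossings X a k b)) \<le> 4" using narrow_crossings[OF True] by simp
    moreover have "c + (4 * (k - a - 1) + 2 * p1 + 136 * s1) + (4 * (b - k - 1) + 2 * p2 + 136 * s2)
        \<le> 4 * (b - a - 1) + 2 * p + 136 * s"
      if "p1 + p2 \<le> p" "c \<le> 4" "n + s1 + s2 \<le> s" "0 \<le> n" for c n p1 p2 p s1 s2 s :: int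
      using that by (simp add: algebra_simps)
    ultimately show ?thesis using S N0 unfolding strip_pot_def by blast
  next
    case False
    obtain Z where Z: "finite Z"
      "\<And>p q. p \<in> strip X a b \<Longrightarrow> q \<in> strip X a b \<Longrightarrow> fst p \<le> k \<Longrightarrow> k < fst q \<Longrightarrow> block p = block q \<Longrightarrow> p \<in> Z \<or> q \<in> Z"
      "int (card Z) \<le> 34 * ?N" by (rule hitting_set[OF ab]) blast
    have "int (card (crossings X a k b)) \<le> 4 * int (card Z) + 2 * min (int m) (min (k - a) (b - k))"
      by (rule crossings_le_hitting[OF Z(1,2) ab])
    moreover have "min (int m) (min (k - a) (b - k)) + pot (int m) (k - a) + pot (int m) (b - k)
        \<le> pot (int m) ((k - a) + (b - k))"
      by (rule pot_split) (use ab False in auto)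
    then have "min (int m) (min (k - a) (b - k)) + pot (int m) (k - a) + pot (int m) (b - k)
        \<le> pot (int m) (b - a)" by simp
    moreover have "c + (4 * (k - a - 1) + 2 * p1 + 136 * s1) + (4 * (b - k - 1) + 2 * p2 + 136 * s2)
        \<le> 4 * (b - a - 1) + 2 * p + 136 * s"
      if "c \<le> 4 * z + 2 * M" "M + p1 + p2 \<le> p" "z \<le> 34 * n" "n + s1 + s2 \<le> s" for c z n p1 p2 p s1 s2 s M :: int
      using that by (simp add: algebra_simps)
    ultimately show ?thesis using Z(3) S unfolding strip_pot_def by blast
  qed
qed

lemma strip_pot_bounds:
  assumes "a < b"
  shows "0 \<le> strip_pot a b" "b - a \<le> int m * Q \<Longrightarrow> strip_pot a b \<le> 552 * int m * (Q + 1)"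
proof -
  have "0 \<le> (\<Sum>i<m. pot (2 ^ i) (weight i a b))" by (intro sum_nonneg pot_nonneg) auto
  then show "0 \<le> strip_pot a b" using assms pot_nonneg[of "int m" "b - a"] unfolding strip_pot_def by simp
  assume Q: "b - a \<le> int m * Q"
  have "weight i a b \<le> 2 * Q" for i
  proof -
    have "res_count m j a b < Q + 1" for j
    proof -
      have "int m * res_count m j a b < int m * (Q + 1)"
        using res_count_bounds(2)[OF m_pos, of j a b] Q by (simp add: distrib_left)
      then show ?thesis using m_pos by simp
    qed
    from this[of 0] this[of i] show ?thesis unfolding weight_def by linarith
  qed
  then have "pot (2 ^ i) (weight i a b) \<le> 4 * Q" for i
    using pot_le[of "2 ^ i" "weight i a b"] weight_nonneg[of a b i] assms by (smt (verit) zero_le_power)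
  then have "(\<Sum>i<m. pot (2 ^ i) (weight i a b)) \<le> (\<Sum>i<m. 4 * Q)" by (intro sum_mono)
  then have "(\<Sum>i<m. pot (2 ^ i) (weight i a b)) \<le> 4 * (int m * Q)" by simp
  moreover have "pot (int m) (b - a) \<le> 2 * (int m * Q)" using pot_le[of "int m" "b - a"] Q assms by simp
  \<comment> \<open>The constant is \<open>4 + 2 * 2 + 136 * 4\<close>: each of the \<open>m\<close>
    classes has potential at most \<open>4 * Q\<close>.\<close>
  moreover have "4 * (x - 1) + 2 * p + 136 * s \<le> 552 * y" if "s \<le> 4 * y" "p \<le> 2 * y" "x \<le> y"
    for x y p s :: int using that by (simp add: algebra_simps)
  ultimately have "strip_pot a b \<le> 552 * (int m * Q)" using Q unfolding strip_pot_def by blast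
  then show "strip_pot a b \<le> 552 * int m * (Q + 1)" by (simp add: distrib_left)
qed

lemma WB_le:
  assumes X: "\<And>p. p \<in> X \<Longrightarrow> 0 \<le> fst p \<and> fst p < int m * Q" and ne: "X \<noteq> {}"
  shows "int (WB X) \<le> 552 * int m * (Q + 1)"
proof -
  let ?S = "{\<sigma>. distinct \<sigma> \<and> set \<sigma> = wilber_lines X}"
  \<comment> \<open>The half-open strip from \<open>?lo\<close> to \<open>?hi\<close> holds exactly
    the coordinates 0 to \<open>m * Q - 1\<close>, so its width is \<open>m * Q\<close>.\<close>
  let ?lo = "-1 :: int" and ?hi = "int m * Q - 1"
  have finl: "finite (wilber_lines X)" by (simp add: wilber_lines_def)
  have lines: "wilber_lines X \<subseteq> {?lo<..<?hi}"
  proof -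
    have "Min (fst ` X) \<in> fst ` X" "Max (fst ` X) \<in> fst ` X" using fin ne by auto
    then show ?thesis using X unfolding wilber_lines_def by fastforce
  qed
  have "?S \<noteq> {}" using finite_distinct_list[OF finl] by auto
  moreover have "finite ?S"
  proof (rule finite_subset[OF _ finite_lists_length_le[OF finl, of "card (wilber_lines X)"]])
    show "?S \<subseteq> {xs. set xs \<subseteq> wilber_lines X \<and> length xs \<le> card (wilber_lines X)}"
      by (auto simp flip: distinct_card)
  qed
  ultimately have "WB X \<in> WB_sigma X ` ?S" unfolding WB_def by (intro Max_in) auto
  then obtain \<sigma> where \<sigma>: "distinct \<sigma>" "set \<sigma> = wilber_lines X" "WB X = WB_sigma X \<sigma>" by auto
  have lohi: "?lo < ?hi" using X ne by force
  have "int (WB_sigma X \<sigma>) \<le> strip_pot ?lo ?hi"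
  proof (rule WB_sigma_le_potential[where w = strip_pot])
    show "?lo < fst p \<and> fst p \<le> ?hi" if "p \<in> X" for p using X[OF that] by auto
    show "set \<sigma> \<subseteq> {?lo<..<?hi}" using \<sigma> lines by simp
  qed (use lohi \<sigma>(1) crossings_le_strip_pot strip_pot_bounds(1) in simp_all)
  also have "\<dots> \<le> 552 * int m * (Q + 1)" by (rule strip_pot_bounds(2)[OF lohi]) simp
  finally show ?thesis using \<sigma> by simp
qed

end

subsection \<open>The point set\<close>

definition shift_point :: "nat \<Rightarrow> nat \<Rightarrow> nat \<Rightarrow> point" where
  "shift_point l s t = (2 ^ l * (int s + 2 ^ (bit_rev l t + 3)) + int (bit_rev l t), 2 ^ l * int s + int t)"

text \<open>With \<open>m = 2 ^ l\<close> there are \<open>2 ^ m\<close> blocks, so the largest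
  shift \<open>2 ^ (m + 2)\<close> is only 4 times their number and the x-range stays linear in the
  number of points.\<close>

definition shift_set :: "nat \<Rightarrow> point set" where
  "shift_set l = (\<lambda>(s, t). shift_point l s t) ` ({..<2 ^ 2 ^ l} \<times> {..<2 ^ l})"

lemma shift_setE:
  assumes "p \<in> shift_set l"
  obtains s t where "p = shift_point l s t" "s < 2 ^ 2 ^ l" "t < 2 ^ l"
  using assms by (auto simp: shift_set_def)

lemma shift_setI: "s < 2 ^ 2 ^ l \<Longrightarrow> t < 2 ^ l \<Longrightarrow> shift_point l s t \<in> shift_set l"
  by (auto simp: shift_set_def)

lemma int_less_pow: "t < 2 ^ l \<Longrightarrow> int t < 2 ^ l"
  by (metis of_nat_less_iff of_nat_numeral of_nat_power)

lemma shift_point_div_mod: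
  assumes "t < 2 ^ l"
  shows "fst (shift_point l s t) div 2 ^ l = int s + 2 ^ (bit_rev l t + 3)"
    "fst (shift_point l s t) mod 2 ^ l = int (bit_rev l t)"
    "snd (shift_point l s t) div 2 ^ l = int s" "snd (shift_point l s t) mod 2 ^ l = int t"
  using int_less_pow[OF assms] int_less_pow[OF bit_rev_less[OF assms]]
  by (simp_all add: shift_point_def)

lemma bit_rev_eqD: "t < 2 ^ l \<Longrightarrow> t' < 2 ^ l \<Longrightarrow> bit_rev l t = bit_rev l t' \<Longrightarrow> t = t'"
  using bit_rev_inj[of l] by (simp add: inj_on_def)

lemma shift_point_fst_inj:
  assumes "t < 2 ^ l" "t' < 2 ^ l" "fst (shift_point l s t) = fst (shift_point l s' t')"
  shows "s = s' \<and> t = t'"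
proof -
  have "int (bit_rev l t) = int (bit_rev l t')"
    using shift_point_div_mod(2)[OF assms(1), of s] shift_point_div_mod(2)[OF assms(2), of s'] assms(3) by simp
  then have b: "bit_rev l t = bit_rev l t'" by simp
  then have "int s = int s'"
    using shift_point_div_mod(1)[OF assms(1), of s] shift_point_div_mod(1)[OF assms(2), of s'] assms(3) by simp
  then show ?thesis using bit_rev_eqD[OF assms(1,2) b] by simp
qed

lemma shift_point_snd_inj:
  assumes "t < 2 ^ l" "t' < 2 ^ l" "snd (shift_point l s t) = snd (shift_point l s' t')"
  shows "s = s' \<and> t = t'"
  using shift_point_div_mod(3,4)[OF assms(1), of s] shift_point_div_mod(3,4)[OF assms(2), of s'] assms(3) by simp

lemma shift_set_inj: "inj_on (\<lambda>(s, t). shift_point l s t) ({..<2 ^ 2 ^ l} \<times> {..<2 ^ l})"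
proof (rule inj_onI)
  fix u v assume uv: "u \<in> {..<2 ^ 2 ^ l} \<times> {..<2 ^ l}" "v \<in> {..<2 ^ 2 ^ l} \<times> {..<2 ^ l}"
    "(\<lambda>(s, t). shift_point l s t) u = (\<lambda>(s, t). shift_point l s t) v"
  obtain s t where u: "u = (s, t)" by (cases u)
  obtain s' t' where v: "v = (s', t')" by (cases v)
  show "u = v" using shift_point_snd_inj[of t l t' s s'] uv u v by simp
qed

lemma finite_shift_set: "finite (shift_set l)"
  by (simp add: shift_set_def)

lemma card_shift_set: "card (shift_set l) = 2 ^ l * 2 ^ 2 ^ l"
  unfolding shift_set_def by (simp add: card_image[OF shift_set_inj] card_cartesian_product)

lemma permutation_shift_set: "is_permutation (shift_set l)"
  unfolding is_permutation_def
proof (intro ballI impI)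
  fix p q assume "p \<in> shift_set l" "q \<in> shift_set l" and eq: "fst p = fst q \<or> snd p = snd q"
  then obtain s t s' t' where "p = shift_point l s t" "q = shift_point l s' t'" "t < 2 ^ l" "t' < 2 ^ l"
    by (metis shift_setE)
  then show "p = q" using shift_point_fst_inj[of t l t' s s'] shift_point_snd_inj[of t l t' s s'] eq by auto
qed

lemma shifted_powers_shift_set: "shifted_powers (2 ^ l) (shift_set l)"
proof
  show "(0::nat) < 2 ^ l" by simp
  show "finite (shift_set l)" by (rule finite_shift_set)
  show "is_permutation (shift_set l)" by (rule permutation_shift_set)
next
  fix p assume "p \<in> shift_set l"
  then obtain s t where "p = shift_point l s t" "t < 2 ^ l" by (rule shift_setE)
  then show "fst p div int (2 ^ l) = snd p div int (2 ^ l) + 2 ^ (nat (fst p mod int (2 ^ l)) + 3)"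
    using shift_point_div_mod[of t l s] by simp
next
  fix p q r assume "p \<in> shift_set l" "q \<in> shift_set l" and
    eq: "fst p mod int (2 ^ l) = fst q mod int (2 ^ l)" and
    le: "snd p div int (2 ^ l) \<le> r" "r \<le> snd q div int (2 ^ l)"
  then obtain s t s' t' where pq: "p = shift_point l s t" "q = shift_point l s' t'" "t < 2 ^ l" "t' < 2 ^ l"
    "s' < 2 ^ 2 ^ l" by (metis shift_setE)
  have r: "int s \<le> r" "r \<le> int s'"
    using le shift_point_div_mod(3)[OF pq(3), of s] shift_point_div_mod(3)[OF pq(4), of s'] pq by simp_all
  have "nat r \<le> s'" using r by linarith
  then have "nat r < 2 ^ 2 ^ l" using pq(5) by (rule le_less_trans)
  moreover have "int (nat r) = r" using r by simp
  ultimately have n: "nat r < 2 ^ 2 ^ l" "int (nat r) = r" .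
  show "\<exists>z\<in>shift_set l. snd z div int (2 ^ l) = r \<and> fst z mod int (2 ^ l) = fst p mod int (2 ^ l)"
    using shift_setI[OF n(1) pq(3)] shift_point_div_mod(2,3)[OF pq(3), of "nat r"]
      shift_point_div_mod(2)[OF pq(3), of s] n(2) pq(1) by (intro bexI) auto
qed

lemma WB_shift_set: "WB (shift_set l) \<le> 3312 * card (shift_set l)"
proof -
  interpret shifted_powers "2 ^ l" "shift_set l" by (rule shifted_powers_shift_set)
  \<comment> \<open>The block index is below \<open>2 ^ 2 ^ l\<close> and the shift at most 4 times
    that. Finally \<open>?Q + 1\<close> is at most 6 times that, and
    \<open>3312 = 6 * 552\<close>.\<close>
  let ?Q = "5 * 2 ^ 2 ^ l :: int"
  have "0 \<le> fst p \<and> fst p < int (2 ^ l) * ?Q" if pX: "p \<in> shift_set l" for p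
  proof -
    from pX obtain s t where p: "p = shift_point l s t" "s < 2 ^ 2 ^ l" "t < 2 ^ l" by (rule shift_setE)
    have i: "bit_rev l t + 3 \<le> 2 ^ l + 2" using bit_rev_less[OF p(3)] by simp
    have "(2::int) ^ (bit_rev l t + 3) \<le> 2 ^ (2 ^ l + 2)" by (rule power_increasing[OF i]) simp
    also have "\<dots> = 4 * 2 ^ 2 ^ l" by (simp add: power_add)
    finally have "int s + 2 ^ (bit_rev l t + 3) + 1 \<le> ?Q" using int_less_pow[OF p(2)] by linarith
    then have "2 ^ l * (int s + 2 ^ (bit_rev l t + 3) + 1) \<le> 2 ^ l * ?Q" by (intro mult_left_mono) auto
    then have "2 ^ l * (int s + 2 ^ (bit_rev l t + 3)) + 2 ^ l \<le> 2 ^ l * ?Q" by (simp only: distrib_left mult_1_right)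
    moreover have "fst p = 2 ^ l * (int s + 2 ^ (bit_rev l t + 3)) + int (bit_rev l t)" by (simp add: p(1) shift_point_def)
    ultimately have "fst p < 2 ^ l * ?Q" using int_less_pow[OF bit_rev_less[OF p(3)]] by linarith
    then show ?thesis using p(1) by (simp add: shift_point_def)
  qed
  moreover have "shift_set l \<noteq> {}" using shift_setI[of 0 l 0] by auto
  ultimately have "int (WB (shift_set l)) \<le> 552 * int (2 ^ l) * (?Q + 1)" by (rule WB_le)
  also have "\<dots> \<le> 552 * int (2 ^ l) * (6 * 2 ^ 2 ^ l)"
    by (rule mult_left_mono) (use one_le_power[of "2::int" "2 ^ l"] in linarith, simp)
  also have "\<dots> = int (3312 * card (shift_set l))" by (simp add: card_shift_set)
  finally show ?thesis by linarith
qed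

section \<open>Funnels and alternations in the point set\<close>

text \<open>The index \<open>j\<close> agrees with that of \<open>t\<close> modulo
  \<open>2 ^ (l - 1 - b)\<close> but not modulo the next power, so \<open>t0\<close> and
  \<open>t\<close> agree above bit \<open>b\<close> and differ there; as \<open>t\<close> has the
  bit set, \<open>t0\<close> is smaller. A point in the box lies in the same block and shares the
  bits above \<open>b\<close>, so its index lies between two consecutive members of one residue
  class and is one of them.\<close>

lemma funnel_shift_set:
  assumes s: "s < 2 ^ 2 ^ l" and t: "t < 2 ^ l" and b: "b < l" and odd: "odd (t div 2 ^ b)"
    and j: "j < 2 ^ l" "j = bit_rev l t + 2 ^ (l - 1 - b) \<or> bit_rev l t = j + 2 ^ (l - 1 - b)"
  obtains t0 where "t0 < 2 ^ l" "bit_rev l t0 = j" "t0 div 2 ^ b + 1 = t div 2 ^ b"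
    "shift_point l s t0 \<in> funnel (shift_set l) (shift_point l s t)"
proof -
  let ?i = "bit_rev l t"
  define k where "k = l - 1 - b"
  have k: "l - k = Suc b" "l - Suc k = b" "Suc k \<le> l" using b by (auto simp: k_def)
  obtain t0 where t0: "t0 < 2 ^ l" "bit_rev l t0 = j" using bit_rev_surj[OF j(1)] by blast
  have j': "j = ?i + 2 ^ k \<or> ?i = j + 2 ^ k" using j(2) by (simp add: k_def)
  have "j mod 2 ^ k = ?i mod 2 ^ k" using j' by auto
  then have eq: "t0 div 2 ^ Suc b = t div 2 ^ Suc b"
    using bit_rev_cong_iff[OF t0(1) t, of k] t0(2) k by simp
  have shift: "(x + 2 ^ k) mod 2 ^ Suc k \<noteq> x mod 2 ^ Suc k" for x :: nat
  proof
    assume "(x + 2 ^ k) mod 2 ^ Suc k = x mod 2 ^ Suc k"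
    then have "(2::nat) ^ Suc k dvd 2 ^ k" by (subst (asm) mod_eq_dvd_iff_nat) auto
    then show False by (auto dest!: dvd_imp_le)
  qed
  have "j mod 2 ^ Suc k \<noteq> ?i mod 2 ^ Suc k" using j' shift[of ?i] shift[of j] by metis
  then have ne: "t0 div 2 ^ b \<noteq> t div 2 ^ b"
    using bit_rev_cong_iff[OF t0(1) t, of "Suc k"] t0(2) k by simp
  have half: "u div 2 ^ Suc b = u div 2 ^ b div 2" for u :: nat by (simp only: power_Suc2 div_mult2_eq)
  have "x + 1 = y" if "x div 2 = y div 2" "x \<noteq> y" "odd y" for x y :: nat using that by presburger
  then have dv: "t0 div 2 ^ b + 1 = t div 2 ^ b" using eq ne odd unfolding half by blast
  have lt: "t0 < t" using dv div_le_mono[of t t0 "2 ^ b"] by (cases "t0 < t") auto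
  let ?p = "shift_point l s t" and ?q = "shift_point l s t0"
  have "r = ?p \<or> r = ?q" if r: "r \<in> shift_set l" "in_box ?p ?q r" for r
  proof -
    from r(1) obtain s' t' where r': "r = shift_point l s' t'" "t' < 2 ^ l" by (rule shift_setE)
    have y: "snd ?q \<le> snd r" "snd r \<le> snd ?p" using r(2) lt by (auto simp: in_box_def shift_point_def)
    have "snd ?q div 2 ^ l \<le> snd r div 2 ^ l" "snd r div 2 ^ l \<le> snd ?p div 2 ^ l"
      using y by (auto intro: zdiv_mono1)
    then have s': "s' = s"
      using shift_point_div_mod(3)[OF t0(1), of s] shift_point_div_mod(3)[OF t, of s]
        shift_point_div_mod(3)[OF r'(2), of s'] r'(1) by simp
    have tt: "t0 \<le> t'" "t' \<le> t" using y r' s' by (auto simp: shift_point_def)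
    then have "t0 div 2 ^ Suc b \<le> t' div 2 ^ Suc b" "t' div 2 ^ Suc b \<le> t div 2 ^ Suc b"
      by (auto intro: div_le_mono)
    then have "t' div 2 ^ Suc b = t div 2 ^ Suc b" using eq by simp
    then have cong: "bit_rev l t' mod 2 ^ k = ?i mod 2 ^ k"
      using bit_rev_cong_iff[OF r'(2) t, of k] k by simp
    have mono: "i' \<le> i''" if "2 ^ l * (2::int) ^ (i' + 3) + int i' \<le> 2 ^ l * 2 ^ (i'' + 3) + int i''" for i' i''
    proof (rule ccontr)
      assume n: "\<not> i' \<le> i''"
      then have "(2::int) ^ l * 2 ^ (i'' + 3) \<le> 2 ^ l * 2 ^ (i' + 3)"
        by (intro mult_left_mono power_increasing) auto
      then show False using that n by linarith
    qed
    have x: "min (fst ?p) (fst ?q) \<le> fst r" "fst r \<le> max (fst ?p) (fst ?q)" using r(2) by (auto simp: in_box_def)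
    have fst_le: "bit_rev l u \<le> bit_rev l v" if "fst (shift_point l s u) \<le> fst (shift_point l s v)" for u v
      using that by (intro mono) (simp add: shift_point_def distrib_left)
    have lo: "min ?i j \<le> bit_rev l t'" and hi: "bit_rev l t' \<le> max ?i j"
      using x fst_le[of t t'] fst_le[of t0 t'] fst_le[of t' t] fst_le[of t' t0] r' s' t0(2)
      by (auto simp: min_def max_def split: if_splits)
    have "bit_rev l t' = ?i \<or> bit_rev l t' = j"
    proof -
      have mid: "x = y \<or> x = y + 2 ^ k" if "y \<le> x" "x \<le> y + 2 ^ k" "x mod 2 ^ k = y mod 2 ^ k" for x y :: nat
      proof -
        have "2 ^ k dvd x - y" using that by (metis mod_eq_dvd_iff_nat)
        then obtain c where c: "x - y = 2 ^ k * c" by (rule dvdE)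
        have "2 ^ k * c \<le> 2 ^ k * 1" using c that(2) by linarith
        then have "c \<le> 1" by simp
        then have "c = 0 \<or> c = 1" by linarith
        then show ?thesis using c that(1) by auto
      qed
      show ?thesis using j'
      proof
        assume "j = ?i + 2 ^ k" then show ?thesis using mid[of ?i "bit_rev l t'"] lo hi cong by auto
      next
        assume e: "?i = j + 2 ^ k"
        then have "bit_rev l t' mod 2 ^ k = j mod 2 ^ k" using cong by simp
        then show ?thesis using mid[of j "bit_rev l t'"] lo hi e by auto
      qed
    qed
    then have "t' = t \<or> t' = t0" using bit_rev_eqD[OF r'(2) t] bit_rev_eqD[OF r'(2) t0(1)] t0(2) by metis
    then show ?thesis using r' s' by auto
  qed
  moreover have "snd ?q < snd ?p" using lt by (simp add: shift_point_def)
  ultimately have "?q \<in> funnel (shift_set l) ?p"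
    using shift_setI[OF s t0(1)] unfolding funnel_def by blast
  then show ?thesis using that t0 dv by blast
qed

text \<open>The range conditions say that both neighbouring indices exist, so that the funnel has a
  point on either side of \<open>t\<close> for this bit.\<close>

definition witness_bits :: "nat \<Rightarrow> nat \<Rightarrow> nat set" where
  "witness_bits l t = {b \<in> {..<l}. odd (t div 2 ^ b) \<and> 2 ^ (l - 1 - b) \<le> bit_rev l t \<and>
     bit_rev l t + 2 ^ (l - 1 - b) < 2 ^ l}"

lemma shift_point_fst_less:
  assumes "bit_rev l t < bit_rev l t'"
  shows "fst (shift_point l s t) < fst (shift_point l s t')"
proof -
  have "(2::int) ^ l * (int s + 2 ^ (bit_rev l t + 3)) \<le> 2 ^ l * (int s + 2 ^ (bit_rev l t' + 3))"
    using assms by (intro mult_left_mono add_left_mono power_increasing) auto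
  then show ?thesis unfolding shift_point_def fst_conv by (rule add_le_less_mono) (use assms in simp)
qed

lemma alt_shift_set:
  assumes s: "s < 2 ^ 2 ^ l" and t: "t < 2 ^ l"
  shows "card (witness_bits l t) \<le> alt (shift_set l) (shift_point l s t)"
proof -
  let ?p = "shift_point l s t"
  \<comment> \<open>Heights above the base of the block in the dyadic interval of length
    \<open>2 ^ b\<close> just below the one containing \<open>t\<close>.\<close>
  let ?J = "\<lambda>b. {y. (y - 2 ^ l * int s) div 2 ^ b + 1 = int (t div 2 ^ b)}"
  have memJ: "snd (shift_point l s t0) \<in> ?J b" if "t0 div 2 ^ b + 1 = t div 2 ^ b" for t0 b
  proof -
    have "int t0 div 2 ^ b = int (t0 div 2 ^ b)" by (simp add: zdiv_int)
    then show ?thesis using that by (simp add: shift_point_def flip: that)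
  qed
  \<comment> \<open>As bit \<open>b\<close> of \<open>t\<close> is set, the window is the lower half
    of the dyadic interval of length \<open>2 ^ (b + 1)\<close> around \<open>t\<close>. For
    \<open>b' > b\<close> it thus lies in the interval of length \<open>2 ^ b'\<close> containing
    \<open>t\<close>, not in the one below.\<close>
  have disj: "?J b \<inter> ?J b' = {}" if b: "b \<in> witness_bits l t" "b < b'" for b b'
  proof (rule ccontr)
    assume "?J b \<inter> ?J b' \<noteq> {}"
    then obtain u where u: "u div 2 ^ b + 1 = int (t div 2 ^ b)" "u div 2 ^ b' + 1 = int (t div 2 ^ b')" by auto
    obtain d where d: "b' = b + Suc d" using b(2) less_iff_Suc_add by auto
    have "odd (int (t div 2 ^ b))" using b(1) unfolding witness_bits_def even_of_nat_iff by blast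
    moreover have "w div 2 = v div 2" if "odd v" "w + 1 = v" for w v :: int using that by presburger
    ultimately have h: "u div 2 ^ b div 2 = int (t div 2 ^ b) div 2" using u(1) by blast
    have "u div 2 ^ b' = u div 2 ^ b div 2 div 2 ^ d" by (simp add: d power_add mult_ac flip: zdiv_zmult2_eq)
    also have "\<dots> = int (t div 2 ^ b div 2 div 2 ^ d)" unfolding h by (simp add: zdiv_int)
    also have "t div 2 ^ b div 2 div 2 ^ d = t div 2 ^ b'" by (simp add: d power_add mult_ac flip: div_mult2_eq)
    finally show False using u(2) by simp
  qed
  show ?thesis
  proof (rule alt_ge_card[OF finite_shift_set permutation_shift_set shift_setI[OF s t], where J = ?J])
    show "finite (witness_bits l t)" by (simp add: witness_bits_def)
  next
    fix b assume "b \<in> witness_bits l t"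
    then have b: "b < l" "odd (t div 2 ^ b)" "2 ^ (l - 1 - b) \<le> bit_rev l t"
      "bit_rev l t + 2 ^ (l - 1 - b) < 2 ^ l" by (auto simp: witness_bits_def)
    have j: "bit_rev l t - 2 ^ (l - 1 - b) < 2 ^ l" using bit_rev_less[OF t] by simp
    obtain t1 where t1: "t1 < 2 ^ l" "bit_rev l t1 = bit_rev l t - 2 ^ (l - 1 - b)" "t1 div 2 ^ b + 1 = t div 2 ^ b"
      "shift_point l s t1 \<in> funnel (shift_set l) ?p"
      by (rule funnel_shift_set[OF s t b(1,2) j]) (use b(3) in auto)
    obtain t2 where t2: "t2 < 2 ^ l" "bit_rev l t2 = bit_rev l t + 2 ^ (l - 1 - b)" "t2 div 2 ^ b + 1 = t div 2 ^ b"
      "shift_point l s t2 \<in> funnel (shift_set l) ?p"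
      by (rule funnel_shift_set[OF s t b(1,2,4)]) auto
    have "(0::nat) < 2 ^ (l - 1 - b)" by simp
    then have "bit_rev l t1 < bit_rev l t" "bit_rev l t < bit_rev l t2" using t1(2) t2(2) b(3) by linarith+
    then show "\<exists>x y. x \<in> funnel (shift_set l) ?p \<and> y \<in> funnel (shift_set l) ?p \<and>
        fst x < fst ?p \<and> fst ?p < fst y \<and> snd x \<in> ?J b \<and> snd y \<in> ?J b"
      using t1(4) t2(4) shift_point_fst_less memJ[OF t1(3)] memJ[OF t2(3)] by blast
  next
    fix b x y z assume xyz: "x \<in> ?J b" "z \<in> ?J b" "x \<le> y" "y \<le> z"
    have "(x - 2 ^ l * int s) div 2 ^ b \<le> (y - 2 ^ l * int s) div 2 ^ b"
      "(y - 2 ^ l * int s) div 2 ^ b \<le> (z - 2 ^ l * int s) div 2 ^ b"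
      using xyz by (auto intro!: zdiv_mono1)
    then show "y \<in> ?J b" using xyz by auto
  next
    fix b b' assume b: "b \<in> witness_bits l t" "b' \<in> witness_bits l t" "b \<noteq> b'"
    then consider "b < b'" | "b' < b" by linarith
    then show "?J b \<inter> ?J b' = {}"
    proof cases
      case 1 then show ?thesis using disj[OF b(1)] by blast
    next
      case 2 then show ?thesis using disj[OF b(2)] by blast
    qed
  qed
qed

text \<open>Double counting by bits: at least half of all \<open>t\<close> have bit \<open>b\<close>
  set, and each of the two range conditions excludes at most \<open>2 ^ (l - 1 - b)\<close> of them
  by injectivity of the reversal. Over all bits these exceptions form a geometric series.\<close>

lemma sum_witness_bits: "l * 2 ^ l \<le> 2 * (\<Sum>t<2 ^ l. card (witness_bits l t)) + 4 * 2 ^ l"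
proof -
  define R where "R t b \<longleftrightarrow> odd (t div 2 ^ b) \<and> 2 ^ (l - 1 - b) \<le> bit_rev l t \<and>
     bit_rev l t + 2 ^ (l - 1 - b) < 2 ^ l" for t b
  have swap: "(\<Sum>t<2 ^ l. card (witness_bits l t)) = (\<Sum>b<l. card {t \<in> {..<2 ^ l}. R t b})"
    unfolding witness_bits_def R_def by (rule sum_multicount_gen) auto
  have few: "card {t. t < 2 ^ l \<and> bit_rev l t \<in> A} \<le> card A" if "finite A" for A
    by (rule card_inj_on_le[OF inj_on_subset[OF bit_rev_inj]]) (use that in auto)
  have ge: "2 ^ (l - 1) \<le> card {t \<in> {..<2 ^ l}. R t b} + 2 * 2 ^ (l - 1 - b)" if b: "b < l" for b
  proof -
    let ?D = "2 ^ (l - 1 - b) :: nat" and ?O = "{t::nat. t < 2 ^ l \<and> odd (t div 2 ^ b)}"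
    let ?R = "{t \<in> {..<2 ^ l}. R t b}" and ?A = "{t. t < 2 ^ l \<and> bit_rev l t \<in> {..<?D}}"
      and ?B = "{t. t < 2 ^ l \<and> bit_rev l t \<in> {2 ^ l - ?D..<2 ^ l}}"
    have "?O \<subseteq> ?R \<union> (?A \<union> ?B)"
      using bit_rev_less[of _ l] by (auto simp: R_def not_le not_less)
    then have "card ?O \<le> card (?R \<union> (?A \<union> ?B))"
      by (rule card_mono[rotated]) simp
    also have "\<dots> \<le> card ?R + (card ?A + card ?B)" by (meson add_mono card_Un_le le_refl le_trans)
    also have "\<dots> \<le> card ?R + (card {..<?D} + card {2 ^ l - ?D..<2 ^ l})"
      by (intro add_mono few) auto
    also have "\<dots> \<le> card ?R + 2 * ?D" by simp
    finally show ?thesis using card_odd_div[OF b] by simp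
  qed
  have "l * 2 ^ (l - 1) = (\<Sum>b<l. 2 ^ (l - 1))" by simp
  also have "\<dots> \<le> (\<Sum>b<l. card {t \<in> {..<2 ^ l}. R t b} + 2 * 2 ^ (l - 1 - b))"
    by (rule sum_mono) (use ge in simp)
  also have "\<dots> = (\<Sum>t<2 ^ l. card (witness_bits l t)) + 2 * (\<Sum>b<l. 2 ^ (l - Suc b))"
    by (simp add: swap sum.distrib sum_distrib_left)
  also have "(\<Sum>b<l. 2 ^ (l - Suc b)) = (\<Sum>b<l. 2 ^ b :: nat)" by (rule sum.nat_diff_reindex)
  also have "(\<Sum>b<l. 2 ^ b :: nat) \<le> 2 ^ l" by (induction l) auto
  finally have "l * 2 ^ (l - 1) \<le> (\<Sum>t<2 ^ l. card (witness_bits l t)) + 2 * 2 ^ l" by simp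
  moreover have "l * 2 ^ l = 2 * (l * 2 ^ (l - 1))" by (cases l) auto
  ultimately show ?thesis by linarith
qed

lemma WB2_shift_set: "l * card (shift_set l) \<le> 2 * WB2 (shift_set l) + 2 * card (shift_set l)"
proof -
  let ?M = "2 ^ 2 ^ l :: nat" and ?S = "\<Sum>t<2 ^ l. card (witness_bits l t)"
  have "(\<Sum>p\<in>shift_set l. alt (shift_set l) p) = (\<Sum>s<?M. \<Sum>t<2 ^ l. alt (shift_set l) (shift_point l s t))"
    unfolding shift_set_def[of l]
    by (subst sum.reindex[OF shift_set_inj]) (simp add: sum.cartesian_product case_prod_unfold flip: shift_set_def)
  also have "(\<Sum>s<?M. ?S) \<le> \<dots>" by (intro sum_mono alt_shift_set) auto
  \<comment> \<open>The summand \<open>card X\<close> of \<open>WB2\<close> reduces the loss of 4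
    per point in \<open>sum_witness_bits\<close> to 2.\<close>
  finally have "card (shift_set l) + ?M * ?S \<le> WB2 (shift_set l)" by (simp add: WB2_def)
  moreover have "?M * (l * 2 ^ l) \<le> ?M * (2 * ?S + 4 * 2 ^ l)" using sum_witness_bits by (rule mult_left_mono) simp
  moreover have "?M * (l * 2 ^ l) = l * card (shift_set l)" "?M * (2 * ?S + 4 * 2 ^ l) = 2 * (?M * ?S) + 4 * card (shift_set l)"
    by (simp_all add: card_shift_set distrib_left)
  ultimately show ?thesis by linarith
qed

section \<open>Iterated logarithms and conclusion\<close>

text \<open>Since \<open>n = 2 ^ (l + 2 ^ l)\<close>, the double logarithm lies between
  \<open>l\<close> and \<open>l + 1\<close>.\<close>

lemma log_card_shift_set:
  assumes "2 \<le> l"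
  defines "n \<equiv> real (card (shift_set l))"
  shows "log 2 (log 2 n) \<le> real l + 1" "1 \<le> log 2 (log 2 (log 2 n))"
proof -
  have n: "n = 2 ^ (l + 2 ^ l)" by (simp add: n_def card_shift_set power_add)
  have ln: "log 2 n = real l + 2 ^ l" unfolding n by (subst log_nat_power) (auto simp: log_def)
  have "real l \<le> 2 ^ l" using of_nat_mono[OF less_imp_le[OF less_exp[of l]], where 'a = real] by simp
  then have "log 2 n \<le> 2 ^ (l + 1)" unfolding ln by simp
  then have "log 2 (log 2 n) \<le> log 2 (2 ^ (l + 1))" by (subst log_le_cancel_iff) (auto simp: ln add_nonneg_pos)
  also have "\<dots> = real l + 1" by (subst log_nat_power) auto
  finally show "log 2 (log 2 n) \<le> real l + 1" .
  have "log 2 (2 ^ l) \<le> log 2 (log 2 n)" unfolding ln by (subst log_le_cancel_iff) (auto simp: add_nonneg_pos)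
  then have 2: "2 \<le> log 2 (log 2 n)" using assms(1) by (subst (asm) log_nat_power) auto
  then have "log 2 2 \<le> log 2 (log 2 (log 2 n))" by (subst log_le_cancel_iff) auto
  then show "1 \<le> log 2 (log 2 (log 2 n))" by simp
qed

theorem theorem4p16:
  shows "\<exists>c1 c2 :: real. c1 > 0 \<and> c2 > 0 \<and>
    (\<forall>n' :: int. \<exists>n :: nat. int n \<ge> n' \<and>
       (\<exists>X :: point set. finite X \<and> card X = n \<and> is_permutation X \<and>
          real (WB2 X) \<ge> c1 * real n * log 2 (log 2 (real n)) \<and>
          real (WB X) \<le> c2 * real n * log 2 (log 2 (log 2 (real n)))))"
proof (rule exI[of _ "1 / 8"], rule exI[of _ 3312], intro conjI allI)
  fix n' :: int
  \<comment> \<open>This gives \<open>n >= l >= n'\<close>, and \<open>l >= 4\<close> ensures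
    \<open>l + 1 <= 4 * (l - 2)\<close>, which turns the bound \<open>n * (l - 2) / 2\<close> on
    \<open>WB2\<close> into the factor 1/8.\<close>
  define l where "l = max 4 (nat n')"
  let ?X = "shift_set l" and ?n = "card (shift_set l)"
  have l: "4 \<le> l" by (simp add: l_def)
  have "l \<le> 2 ^ l * 1" using less_exp[of l] by simp
  also have "\<dots> \<le> 2 ^ l * 2 ^ 2 ^ l" by (rule mult_le_mono2) simp
  finally have "nat n' \<le> ?n" by (simp add: l_def card_shift_set)
  then have "n' \<le> int ?n" by simp
  moreover have "1 / 8 * real ?n * log 2 (log 2 (real ?n)) \<le> real (WB2 ?X)"
  proof -
    have "1 / 8 * real ?n * log 2 (log 2 (real ?n)) \<le> 1 / 8 * real ?n * (real l + 1)"
      using log_card_shift_set(1)[of l] l by (intro mult_left_mono) auto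
    also have "\<dots> \<le> 1 / 2 * real ?n * (real l - 2)"
    proof -
      have "real ?n * (real l + 1) \<le> real ?n * (4 * (real l - 2))" by (rule mult_left_mono) (use l in auto)
      then show ?thesis by (simp add: field_simps)
    qed
    also have "\<dots> \<le> real (WB2 ?X)"
    proof -
      have "real (l * ?n) \<le> real (2 * WB2 ?X + 2 * ?n)" using WB2_shift_set[of l] by (rule of_nat_mono)
      then show ?thesis by (simp add: algebra_simps)
    qed
    finally show ?thesis .
  qed
  \<comment> \<open>The bound on \<open>WB\<close> is linear in \<open>n\<close>, and the triple
    logarithm is at least 1.\<close>
  moreover have "real (WB ?X) \<le> 3312 * real ?n * log 2 (log 2 (log 2 (real ?n)))"
  proof -
    have "real (WB ?X) \<le> real (3312 * ?n)" using WB_shift_set[of l] by (rule of_nat_mono)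
    also have "\<dots> = 3312 * real ?n * 1" by simp
    also have "\<dots> \<le> 3312 * real ?n * log 2 (log 2 (log 2 (real ?n)))"
      using log_card_shift_set(2)[of l] l by (intro mult_left_mono) auto
    finally show ?thesis .
  qed
  ultimately show "\<exists>n. n' \<le> int n \<and> (\<exists>X. finite X \<and> card X = n \<and> is_permutation X \<and>
      1 / 8 * real n * log 2 (log 2 (real n)) \<le> real (WB2 X) \<and>
      real (WB X) \<le> 3312 * real n * log 2 (log 2 (log 2 (real n))))"
    using finite_shift_set permutation_shift_set by blast
qed simp_all

end
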